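(* The following hold: $$\frac{8}{\pi^3}\int_0^1K(k)K'(k)\log\!\left(\frac{1+k}{1-k}\right)\frac{dk}{k}=2\sum_{n=0}^\infty\frac{1}{(2n+1)^2}\sum_{k=0}^{n}\frac{4k+1}{2^{8k}}\binom{2k}{k}^4,$$ $$\frac{14\zeta(3)}{\pi^2}+\sum_{n=0}^\infty\frac{1}{2^{8n}}\binom{2n}{n}^4\frac{1}{2n+1}=2\sum_{n=0}^\infty\frac{1}{(2n+1)^2}\sum_{k=0}^{n}\frac{4k+1}{2^{8k}}\binom{2k}{k}^4.$$
   Context: $K(k)=\frac{\pi}{2}\,{}_2F_1\!\left(\tfrac12,\tfrac12;1;k^2\right)$ and $K'(k)=\frac{\pi}{2}\,{}_2F_1\!\left(\tfrac12,\tfrac12;1;1-k^2\right)$. *)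

theory Defs
  imports "HOL-Analysis.Analysis"
begin

text \<open>The Gauss hypergeometric function on its disc of convergence: the value at \<open>z\<close> is
  the sum of the series, hence meaningful for \<open>\<bar>z\<bar> < 1\<close>.\<close>

definition hyp2F1 :: "real \<Rightarrow> real \<Rightarrow> real \<Rightarrow> real \<Rightarrow> real" where
  "hyp2F1 a b c z = eval_fps (fps_hypergeo [a, b] [c] 1) z"

lemma hyp2F1_series:
  "hyp2F1 a b c z = (\<Sum>n. pochhammer a n * pochhammer b n / (pochhammer c n * fact n) * z ^ n)"
  by (simp add: hyp2F1_def eval_fps_def)

definition ellK :: "real \<Rightarrow> real" where
  "ellK k = pi / 2 * hyp2F1 (1/2) (1/2) 1 (k\<^sup>2)"

text \<open>The prime denotes the complementary integral, not a derivative.\<close>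

definition ellK' :: "real \<Rightarrow> real" where
  "ellK' k = pi / 2 * hyp2F1 (1/2) (1/2) 1 (1 - k\<^sup>2)"

text \<open>The Riemann zeta function for real \<open>s > 1\<close>, where the Dirichlet series converges.\<close>

definition real_zeta :: "real \<Rightarrow> real" where
  "real_zeta s = (\<Sum>n. 1 / real (Suc n) powr s)"

end

theory Submission
  imports Defs "HOL-Real_Asymp.Real_Asymp"
begin

text \<open>
  Write \<open>c\<^sub>n = binom(2n, n) / 4\<^sup>n\<close>. Expanding \<open>K\<close> and the logarithm in powers of \<open>k\<close> and
  using \<open>\<integral>\<^sub>0\<^sup>1 K'(k) k\<^sup>2\<^sup>j dk = \<pi>\<^sup>2/4 c\<^sub>j\<^sup>2\<close> turns the integral into \<open>2 X\<close>, where
  \<open>X = \<Sum>\<^sub>m C\<^sub>m / (2m + 1)\<close> and \<open>C\<^sub>m = \<Sum>\<^sub>i c\<^sub>i\<^sup>2 c\<^sub>i\<^sub>+\<^sub>m\<^sup>2\<close>. Behind \<open>C\<^sub>m\<close> stands the Legendre series of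
  \<open>K K'\<close> on \<open>[0, 1]\<close> in the variable \<open>u = k\<^sup>2\<close>, which has the coefficients \<open>(4n + 1) c\<^sub>n\<^sup>4\<close> (up to a
  constant) at \<open>P\<^sub>2\<^sub>n(1 - 2u)\<close>: it yields \<open>2 C\<^sub>m = \<Sum>\<^sub>n (4n + 1) c\<^sub>n\<^sup>4 q\<^sub>n\<^sub>,\<^sub>m\<close> with the moments
  \<open>q\<^sub>n\<^sub>,\<^sub>m\<close> of \<open>P\<^sub>2\<^sub>n\<close>. This identity is proved by showing that both sides satisfy the same
  second-order recurrence in \<open>m\<close>. Summing over \<open>m\<close> first gives
  \<open>\<Sum>\<^sub>m q\<^sub>n\<^sub>,\<^sub>m / (2m + 1) = 2 \<Sum>\<^sub>j\<^sub>\<ge>\<^sub>n (2j + 1)\<^sup>-\<^sup>2\<close>, hence the double sum of the theorem, and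
  \<open>\<Sum>\<^sub>m q\<^sub>n\<^sub>,\<^sub>m\<^sub>+\<^sub>1 / (2m + 1) = 1 / ((4n + 1)(2n + 1))\<close>, hence
  \<open>X' = \<Sum>\<^sub>m C\<^sub>m\<^sub>+\<^sub>1 / (2m + 1) = \<Sum>\<^sub>n c\<^sub>n\<^sup>4 / (4n + 2)\<close>.

  For the second identity, \<open>X - X' = \<Sum>\<^sub>i\<^sub>,\<^sub>l c\<^sub>i\<^sup>2 c\<^sub>l\<^sup>2 / (2(l - i) + 1)\<close> over all pairs. Its row sums
  agree with those of \<open>c\<^sub>i\<^sup>2 c\<^sub>l\<^sup>2 / (2(i + l + 1))\<close>, and this Hilbert form is diagonalised by the
  shifted Legendre polynomials, which leaves a multiple of \<open>\<Sum>\<^sub>n (2n + 1)\<^sup>-\<^sup>3 = 7/8 \<zeta>(3)\<close>.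
\<close>

subsection \<open>Central binomial coefficients\<close>

definition cbin :: "nat \<Rightarrow> real" where
  "cbin n = real ((2 * n) choose n) / 4 ^ n"

lemma cbin_0 [simp]: "cbin 0 = 1"
  by (simp add: cbin_def)

lemma cbin_Suc: "cbin (Suc n) = cbin n * ((2 * real n + 1) / (2 * real n + 2))"
proof -
  have "real ((2 * Suc n) choose Suc n) * (real n + 1) = real ((2 * n) choose n) * (2 * (2 * real n + 1))"
  proof -
    have "Suc n * ((2 * Suc n) choose Suc n) = (2 * Suc n) * (Suc (2 * n) choose n)"
      using Suc_times_binomial_eq[of "Suc (2 * n)" n] by (simp add: algebra_simps)
    moreover have "Suc n * (Suc (2 * n) choose n) = Suc (2 * n) * ((2 * n) choose n)"
      using binomial_absorb_comp[of "Suc (2*n)" n] Suc_diff_le[of n "2*n"] by (simp add: algebra_simps)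
    ultimately have "Suc n * (Suc n * ((2 * Suc n) choose Suc n)) = Suc n * (2 * (Suc (2 * n) * ((2 * n) choose n)))"
      by (metis mult.assoc mult.commute)
    then have "Suc n * ((2 * Suc n) choose Suc n) = 2 * (Suc (2 * n) * ((2 * n) choose n))"
      by (metis mult_cancel1 nat.distinct(1))
    from arg_cong[OF this, of real] show ?thesis by (simp add: algebra_simps)
  qed
  moreover have "B * (n' + 1) = A * (2 * (2 * n' + 1)) \<Longrightarrow> n' \<ge> 0 \<Longrightarrow> e > 0 \<Longrightarrow>
      B / (4 * e) = A / e * ((2 * n' + 1) / (2 * n' + 2))" for A B n' e :: real
    by (simp add: divide_simps add_nonneg_eq_0_iff) (simp add: algebra_simps)
  ultimately show ?thesis
    unfolding cbin_def power_Suc by simp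
qed

lemma cbin_pos [simp]: "cbin n > 0"
  by (simp add: cbin_def)

lemma cbin_nonzero [simp]: "cbin n \<noteq> 0"
  using cbin_pos[of n] by linarith

lemma cbin_nonneg [simp]: "cbin n \<ge> 0"
  using cbin_pos[of n] by linarith

text \<open>The induction step is \<open>(2n + 1)(2n + 3) \<le> (2n + 2)^2\<close>. This decay bound
  drives the convergence estimates that follow.\<close>

lemma cbin_sq_le: "cbin n ^ 2 \<le> 1 / (2 * real n + 1)"
proof (induction n)
  case (Suc n)
  have "cbin (Suc n) ^ 2 \<le> 1 / (2 * real n + 1) * ((2 * real n + 1) / (2 * real n + 2)) ^ 2"
    unfolding cbin_Suc power_mult_distrib by (intro mult_right_mono Suc) auto
  also have "\<dots> = (2 * real n + 1) / (2 * real n + 2) ^ 2"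
    by (simp add: power_divide power2_eq_square add_nonneg_eq_0_iff)
  also have "\<dots> \<le> 1 / (2 * real (Suc n) + 1)"
    by (simp add: divide_simps power2_eq_square) (simp add: algebra_simps)
  finally show ?case .
qed simp

lemma cbin_sq_le_1: "cbin n ^ 2 \<le> 1"
  using cbin_sq_le[of n] by (rule order_trans) simp

lemma cbin_sq_asymp: "(\<lambda>n. real n * cbin n ^ 2) \<longlonglongrightarrow> 1 / pi"
proof -
  \<comment> \<open>The partial products of Wallis are exactly \<open>1 / ((2n + 1) c_n^2)\<close>,
    so the asymptotics of \<open>cbin\<close> are Wallis' formula.\<close>
  have eq: "(\<Prod>k=1..n. (4 * real k ^ 2) / (4 * real k ^ 2 - 1)) = 1 / ((2 * real n + 1) * cbin n ^ 2)" for n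
  proof (induction n)
    case (Suc n)
    have step: "1 / ((2 * r + 1) * d) * (4 * (r + 1) ^ 2 / (4 * (r + 1) ^ 2 - 1)) =
        1 / ((2 * (r + 1) + 1) * (d * ((2 * r + 1) / (2 * r + 2)) ^ 2))" if "r \<ge> 0" "d > 0" for r d :: real
    proof -
      have f: "4 * (r + 1) ^ 2 - 1 = (2 * r + 1) * (2 * r + 3)" "4 * (r + 1) ^ 2 = (2 * r + 2) ^ 2"
        "2 * (r + 1) + 1 = 2 * r + 3"
        by (simp_all add: power2_eq_square algebra_simps)
      define p q where "p = 2 * r + 1" and "q = 2 * r + 3"
      have "p > 0" "q > 0" using that by (auto simp: p_def q_def)
      then show ?thesis
        unfolding f(1) unfolding f(2,3) power_divide p_def[symmetric] q_def[symmetric] using that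
        by (simp add: power2_eq_square)
    qed
    show ?case
      using step[of "real n" "cbin n ^ 2"] Suc unfolding cbin_Suc power_mult_distrib
      by (simp add: add.commute)
  qed simp
  have "(\<lambda>n. 1 / ((2 * real n + 1) * cbin n ^ 2)) \<longlonglongrightarrow> pi / 2"
    using wallis unfolding eq .
  then have "(\<lambda>n. inverse (1 / ((2 * real n + 1) * cbin n ^ 2))) \<longlonglongrightarrow> inverse (pi / 2)"
    by (rule tendsto_inverse) simp
  then have "(\<lambda>n. (2 * real n + 1) * cbin n ^ 2) \<longlonglongrightarrow> 2 / pi"
    by simp
  moreover have "(\<lambda>n. real n / (2 * real n + 1)) \<longlonglongrightarrow> 1 / 2"
    by real_asymp
  ultimately have "(\<lambda>n. real n / (2 * real n + 1) * ((2 * real n + 1) * cbin n ^ 2)) \<longlonglongrightarrow> 1 / 2 * (2 / pi)"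
    by (intro tendsto_mult)
  moreover have "real n / (2 * real n + 1) * ((2 * real n + 1) * cbin n ^ 2) = real n * cbin n ^ 2" for n
    by (simp add: field_simps add_nonneg_eq_0_iff)
  ultimately show ?thesis by simp
qed

lemma summable_inverse_odd_power: "p \<ge> 2 \<Longrightarrow> summable (\<lambda>n. 1 / (2 * real n + 1) ^ p)"
  by (rule summable_comparison_test_ev[OF _ inverse_power_summable[of p, where 'a = real]])
     (auto simp: eventually_sequentially field_simps intro!: exI[of _ 1] power_mono)

lemma cbin_pow4_le: "cbin n ^ 4 \<le> 1 / (2 * real n + 1) ^ 2"
proof -
  have "cbin n ^ 4 = (cbin n ^ 2) ^ 2" by simp
  also have "\<dots> \<le> (1 / (2 * real n + 1)) ^ 2"
    by (intro power_mono cbin_sq_le) simp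
  finally show ?thesis by (simp add: power_divide)
qed

lemma summable_cbin_pow4: "summable (\<lambda>n. cbin n ^ 4)"
  by (rule summable_comparison_test'[OF summable_inverse_odd_power[of 2], of 0])
     (use cbin_pow4_le in \<open>auto simp: abs_of_nonneg\<close>)

subsection \<open>Moments of Legendre polynomials\<close>

text \<open>For \<open>x > 0\<close> this is \<open>\<integral>\<^sub>0\<^sup>1 P\<^sub>N(1 - 2u) u\<^bsup>x - 1\<^esup> du\<close> up to the sign \<open>(-1)\<^sup>N\<close>.\<close>

definition legm :: "nat \<Rightarrow> real \<Rightarrow> real" where
  "legm N x = (\<Prod>j=1..N. (x - real j) / (x + real j)) / x"

lemma legm_0 [simp]: "legm 0 x = 1 / x"
  by (simp add: legm_def)

lemma legm_Suc: "legm (Suc N) x = legm N x * ((x - real N - 1) / (x + real N + 1))"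
  by (simp add: legm_def algebra_simps)

text \<open>Numerators and denominators of the product move by one place, so all but the end factors
  cancel. The relation is kept free of division because \<open>x = N\<close> is a case of interest
  at integer arguments.\<close>

lemma legm_shift:
  assumes "x > 0"
  shows "legm N (x + 1) * ((x - real N) * (x + real N + 1)) = legm N x * x ^ 2"
proof (induction N)
  case (Suc N)
  have "legm (Suc N) (x + 1) * ((x - real (Suc N)) * (x + real (Suc N) + 1)) =
      (legm N (x + 1) * ((x - real N) * (x + real N + 1))) * ((x - real N - 1) / (x + real N + 1))"
    using assms by (simp add: legm_Suc divide_simps)
  also have "\<dots> = legm (Suc N) x * x ^ 2"
    by (simp add: Suc legm_Suc)
  finally show ?case .
qed (use assms in \<open>simp add: field_simps power2_eq_square\<close>)

text \<open>For \<open>x \<le> 2 N\<^sup>2\<close> the \<open>N\<close>-th factor is at most \<open>(2N - 1) / (2N + 1)\<close>; for larger \<open>x\<close>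
  the right-hand side exceeds the trivial bound \<open>1 / x\<close>.\<close>

lemma legm_bound:
  assumes "x \<ge> 1 / 2"
  shows "\<bar>legm N x\<bar> \<le> 2 * sqrt (2 * x) / (x * (2 * real N + 1))"
proof -
  define P where "P N = (\<Prod>j=1..N. \<bar>x - real j\<bar> / (x + real j))" for N
  have P1: "P N \<le> 1" for N
    unfolding P_def using assms by (intro prod_le_1) (auto simp: divide_simps)
  have P0: "P N \<ge> 0" for N
    unfolding P_def using assms by (intro prod_nonneg) auto
  have s1: "sqrt (2 * x) \<ge> 1" using assms by simp
  have main: "P N \<le> 2 * sqrt (2 * x) / (2 * real N + 1)" for N
  proof (induction N)
    case (Suc N)
    define n where "n = real (Suc N)"
    have n1: "n \<ge> 1" by (simp add: n_def)
    show ?case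
    proof (cases "x \<le> 2 * n ^ 2")
      case True
      have *: "\<bar>x - n\<bar> / (x + n) \<le> (2 * n - 1) / (2 * n + 1)"
      proof -
        have "(x - n) * (2 * n + 1) \<le> (2 * n - 1) * (x + n)"
          using True by (simp add: algebra_simps power2_eq_square)
        moreover have "(n - x) * (2 * n + 1) \<le> (2 * n - 1) * (x + n)"
        proof -
          have "n * 1 \<le> n * (2 * x)" using assms n1 by (intro mult_left_mono) auto
          then show ?thesis by (simp add: algebra_simps)
        qed
        ultimately have "\<bar>x - n\<bar> * (2 * n + 1) \<le> (2 * n - 1) * (x + n)"
          by (simp add: abs_if)
        then show ?thesis using assms n1 by (simp add: divide_simps) 
      qed
      moreover have "P (Suc N) = P N * (\<bar>x - n\<bar> / (x + n))"
        by (simp add: P_def n_def)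
      ultimately have "P (Suc N) \<le> 2 * sqrt (2 * x) / (2 * real N + 1) * ((2 * n - 1) / (2 * n + 1))"
        using mult_mono[OF Suc *] assms n1 by simp
      also have "2 * real N + 1 = 2 * n - 1" by (simp add: n_def)
      finally show ?thesis using n1 by (simp add: n_def)
    next
      case False
      then have "(2 * n) ^ 2 \<le> 2 * x" by (simp add: power2_eq_square)
      then have "2 * n \<le> sqrt (2 * x)"
        using n1 by (intro real_le_rsqrt)
      then have "1 \<le> 2 * sqrt (2 * x) / (2 * n + 1)"
        using n1 s1 by (simp add: divide_simps)
      with P1[of "Suc N"] show ?thesis unfolding n_def by linarith
    qed
  next
    case 0
    show ?case
      using P1[of 0] s1 unfolding of_nat_0 mult_zero_right add_0 div_by_1 by linarith
  qed
  have "\<bar>legm N x\<bar> = P N / x"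
    using assms by (simp add: legm_def P_def abs_prod)
  also have "\<dots> \<le> 2 * sqrt (2 * x) / (2 * real N + 1) / x"
    using main assms by (intro divide_right_mono) auto
  finally show ?thesis by (simp add: field_simps)
qed

subsection \<open>The Legendre expansion of the correlations\<close>

definition corr :: "nat \<Rightarrow> real" where
  "corr m = (\<Sum>i. cbin i ^ 2 * cbin (i + m) ^ 2)"

lemma corr_term_le: "cbin i ^ 2 * cbin (i + m) ^ 2 \<le> 1 / (2 * real i + 1) ^ 2"
proof -
  have "cbin i ^ 2 * cbin (i + m) ^ 2 \<le> 1 / (2 * real i + 1) * (1 / (2 * real (i + m) + 1))"
    by (intro mult_mono cbin_sq_le) auto
  also have "\<dots> \<le> 1 / (2 * real i + 1) * (1 / (2 * real i + 1))"
    by (intro mult_left_mono divide_left_mono) auto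
  finally show ?thesis by (simp add: power2_eq_square)
qed

lemma summable_corr: "summable (\<lambda>i. cbin i ^ 2 * cbin (i + m) ^ 2)"
  by (rule summable_comparison_test'[OF summable_inverse_odd_power[of 2], of 0])
     (use corr_term_le[of _ m] in auto)

lemma corr_sums: "(\<lambda>i. cbin i ^ 2 * cbin (i + m) ^ 2) sums corr m"
  using summable_corr unfolding corr_def by (rule summable_sums)

lemma corr_nonneg: "corr m \<ge> 0"
  unfolding corr_def by (intro suminf_nonneg summable_corr) auto

text \<open>The certificates below, which turn the recurrences into telescoping sums, come from
  Zeilberger's algorithm.\<close>

definition corr_cert :: "nat \<Rightarrow> nat \<Rightarrow> real" where
  "corr_cert m i = cbin i ^ 2 * cbin (i + m) ^ 2 * real i ^ 2 / real (i + m + 1) ^ 2 *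
     (2 * real m + 3 - 8 * (real m + 1) * real (i + m + 1))"

text \<open>The certificate equation with the transcendental part made free: \<open>A\<close>,
  \<open>B\<close> stand for \<open>cbin i ^ 2\<close>, \<open>cbin (i + m) ^ 2\<close>, while
  \<open>s = i + m + 1\<close> and \<open>M = m + 1\<close>. Multiplying by
  \<open>16 s^2 (s + 1)^2\<close> leaves a polynomial identity.\<close>

lemma corr_cert_identity:
  fixes A B i s M :: real
  assumes "i \<ge> 0" "s > 0"
    and "M = s - i"
  shows "(2 * M + 1) ^ 3 * (A * (B * ((2 * s - 1) / (2 * s)) ^ 2 * ((2 * s + 1) / (2 * s + 2)) ^ 2))
    - 4 * M * (4 * M ^ 2 + 1) * (A * (B * ((2 * s - 1) / (2 * s)) ^ 2)) + (2 * M - 1) ^ 3 * (A * B) =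
    A * ((2 * i + 1) / (2 * i + 2)) ^ 2 * (B * ((2 * s - 1) / (2 * s)) ^ 2) * (i + 1) ^ 2 / (s + 1) ^ 2 *
      (2 * M + 1 - 8 * M * (s + 1)) - A * B * i ^ 2 / s ^ 2 * (2 * M + 1 - 8 * M * s)"
proof -
  have f: "(2 * i + 1) / (2 * i + 2) = (2 * i + 1) / (i + 1) / 2" "(2 * s + 1) / (2 * s + 2) = (2 * s + 1) / (s + 1) / 2"
    using assms by (simp_all add: field_simps)
  define p where "p = s + 1"
  define j where "j = i + 1"
  have nz: "p \<noteq> 0" "j \<noteq> 0" "s \<noteq> 0" using assms by (auto simp: p_def j_def)
  have lhs: "16 * s ^ 2 * p ^ 2 * (u * (A * (B * (k / (2 * s)) ^ 2 * (l / p / 2) ^ 2)) -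
      v * (A * (B * (k / (2 * s)) ^ 2)) + w * (A * B)) =
      A * B * (u * k ^ 2 * l ^ 2 - 4 * v * k ^ 2 * p ^ 2 + 16 * s ^ 2 * p ^ 2 * w)" for u v w k l
    using nz by (simp add: field_simps)
  have rhs: "16 * s ^ 2 * p ^ 2 * (A * (k / j / 2) ^ 2 * (B * (l / (2 * s)) ^ 2) * j ^ 2 / p ^ 2 * u - A * B * i ^ 2 / s ^ 2 * v) =
      A * B * (k ^ 2 * l ^ 2 * u - 16 * i ^ 2 * p ^ 2 * v)" for u v k l
    using nz by (simp add: field_simps)
  have "(2 * M + 1) ^ 3 * (2 * s - 1) ^ 2 * (2 * s + 1) ^ 2 -
      4 * (4 * M * (4 * M ^ 2 + 1)) * (2 * s - 1) ^ 2 * p ^ 2 + 16 * s ^ 2 * p ^ 2 * (2 * M - 1) ^ 3 =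
      (2 * i + 1) ^ 2 * (2 * s - 1) ^ 2 * (2 * M + 1 - 8 * M * p) - 16 * i ^ 2 * p ^ 2 * (2 * M + 1 - 8 * M * s)"
    unfolding p_def assms(3) by algebra
  then have "16 * s ^ 2 * p ^ 2 *
    ((2 * M + 1) ^ 3 * (A * (B * ((2 * s - 1) / (2 * s)) ^ 2 * ((2 * s + 1) / p / 2) ^ 2))
    - 4 * M * (4 * M ^ 2 + 1) * (A * (B * ((2 * s - 1) / (2 * s)) ^ 2)) + (2 * M - 1) ^ 3 * (A * B)) =
    16 * s ^ 2 * p ^ 2 * (A * ((2 * i + 1) / j / 2) ^ 2 * (B * ((2 * s - 1) / (2 * s)) ^ 2) * j ^ 2 / p ^ 2 *
      (2 * M + 1 - 8 * M * p) - A * B * i ^ 2 / s ^ 2 * (2 * M + 1 - 8 * M * s))"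
    unfolding lhs rhs by (simp only:)
  then show ?thesis
    using nz unfolding f p_def[symmetric] j_def[symmetric]
    by (metis mult_left_cancel no_zero_divisors power_not_zero zero_neq_numeral)
qed

lemma corr_cert_diff:
  "(2 * real m + 3) ^ 3 * (cbin i ^ 2 * cbin (i + (m + 2)) ^ 2)
   - 4 * (real m + 1) * (4 * (real m + 1) ^ 2 + 1) * (cbin i ^ 2 * cbin (i + (m + 1)) ^ 2)
   + (2 * real m + 1) ^ 3 * (cbin i ^ 2 * cbin (i + m) ^ 2) = corr_cert m (Suc i) - corr_cert m i"
proof -
  define s where "s = real i + real m + 1"
  have e: "2 * real (i + m) + 1 = 2 * s - 1" "2 * real (i + m) + 2 = 2 * s"
    "2 * real (i + (m + 1)) + 1 = 2 * s + 1" "2 * real (i + (m + 1)) + 2 = 2 * s + 2"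
    "real (Suc i + m + 1) = s + 1" "real (i + m + 1) = s" "real (Suc i) = real i + 1"
    by (simp_all add: s_def)
  have c: "cbin (i + (m + 1)) = cbin (i + m) * ((2 * s - 1) / (2 * s))"
    "cbin (i + (m + 2)) = cbin (i + m) * ((2 * s - 1) / (2 * s)) * ((2 * s + 1) / (2 * s + 2))"
    using cbin_Suc[of "i + m"] cbin_Suc[of "i + (m + 1)"] unfolding e by simp_all
  have c': "cbin (Suc i + m) = cbin (i + m) * ((2 * s - 1) / (2 * s))"
    using c(1) by simp
  define M where "M = real m + 1"
  have M: "2 * real m + 3 = 2 * M + 1" "2 * real m + 1 = 2 * M - 1" "M = s - real i"
    by (simp_all add: M_def s_def)
  show ?thesis
    unfolding corr_cert_def c c' cbin_Suc[of i] e power_mult_distrib M(1,2) M_def[symmetric]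
    by (rule corr_cert_identity[OF _ _ M(3)]) (simp_all add: s_def)
qed

text \<open>The bracket grows linearly in \<open>i + m + 1\<close>; this is absorbed by the bound on
  \<open>cbin (i + m) ^ 2\<close>, and the bound on \<open>cbin i ^ 2\<close> still gives decay of
  order \<open>1/i\<close>.\<close>

lemma corr_cert_lim: "corr_cert m \<longlonglongrightarrow> 0"
proof (rule tendsto_0_le)
  show "(\<lambda>i. 8 * (real m + 1) * (1 / (2 * real i + 1))) \<longlonglongrightarrow> 0"
    by real_asymp
  show "\<forall>\<^sub>F i in sequentially. norm (corr_cert m i) \<le> norm (8 * (real m + 1) * (1 / (2 * real i + 1))) * 1"
  proof (rule always_eventually, rule allI)
    fix i
    define s where "s = real (i + m + 1)"
    have s: "s > 0" "real i \<le> s" "s \<le> 2 * real (i + m) + 1" "s \<ge> real m + 1" by (auto simp: s_def)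
    have "real m * 1 \<le> real m * s" using s by (intro mult_left_mono) auto
    then have z: "\<bar>2 * real m + 3 - 8 * (real m + 1) * s\<bar> \<le> 8 * (real m + 1) * s"
      using s by (simp add: algebra_simps abs_if)
    have r: "real i ^ 2 / s ^ 2 \<le> 1"
      using s by (simp add: power_mono)
    have "norm (corr_cert m i) = cbin i ^ 2 * cbin (i + m) ^ 2 * (real i ^ 2 / s ^ 2) *
        \<bar>2 * real m + 3 - 8 * (real m + 1) * s\<bar>"
      unfolding corr_cert_def s_def[symmetric] by (simp add: abs_mult)
    also have "\<dots> \<le> (1 / (2 * real i + 1) * (1 / (2 * real (i + m) + 1)) * 1) * (8 * (real m + 1) * s)"
      by (intro mult_mono cbin_sq_le z r) (use s in auto)
    also have "\<dots> = 8 * (real m + 1) * (1 / (2 * real i + 1)) * (s / (2 * real (i + m) + 1))"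
      by simp
    also have "\<dots> \<le> 8 * (real m + 1) * (1 / (2 * real i + 1)) * 1"
      using s by (intro mult_left_mono) auto
    finally show "norm (corr_cert m i) \<le> norm (8 * (real m + 1) * (1 / (2 * real i + 1))) * 1"
      by simp
  qed
qed

text \<open>Summing the certificate over \<open>i\<close> leaves two boundary terms: the limit is 0,
  and the factor \<open>i^2\<close> kills the term at \<open>i = 0\<close>.\<close>

lemma corr_rec:
  "(2 * real m + 3) ^ 3 * corr (m + 2)
   - 4 * (real m + 1) * (4 * (real m + 1) ^ 2 + 1) * corr (m + 1)
   + (2 * real m + 1) ^ 3 * corr m = 0"
proof -
  have "(\<lambda>i. corr_cert m (Suc i) - corr_cert m i) sums (0 - corr_cert m 0)"
    by (rule telescope_sums[OF corr_cert_lim])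
  moreover have "(\<lambda>i. corr_cert m (Suc i) - corr_cert m i) sums ((2 * real m + 3) ^ 3 * corr (m + 2)
   - 4 * (real m + 1) * (4 * (real m + 1) ^ 2 + 1) * corr (m + 1) + (2 * real m + 1) ^ 3 * corr m)"
    unfolding corr_cert_diff[symmetric]
    by (intro sums_add sums_diff sums_mult corr_sums)
  moreover have "corr_cert m 0 = 0"
    by (simp add: corr_cert_def)
  ultimately show ?thesis
    using sums_unique2 by fastforce
qed

section \<open>The Legendre series as a function of the exponent\<close>

definition legw :: "nat \<Rightarrow> real" where
  "legw n = (4 * real n + 1) * cbin n ^ 4"

lemma legw_nonneg: "legw n \<ge> 0"
  by (simp add: legw_def)

text \<open>The factor \<open>1 / (4n + 1)\<close> from \<open>legm_bound\<close> cancels the growth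
  of the weight, leaving the summable \<open>cbin n ^ 4\<close>.\<close>

lemma legw_legm_bound:
  assumes "x \<ge> 1 / 2"
  shows "\<bar>legw n * legm (2 * n) x\<bar> \<le> 2 * sqrt (2 * x) / x * cbin n ^ 4"
proof -
  have "\<bar>legw n * legm (2 * n) x\<bar> \<le> legw n * (2 * sqrt (2 * x) / (x * (2 * real (2 * n) + 1)))"
    unfolding abs_mult abs_of_nonneg[OF legw_nonneg]
    by (intro mult_left_mono legm_bound assms legw_nonneg)
  also have "\<dots> = 2 * sqrt (2 * x) / x * cbin n ^ 4"
    using assms by (simp add: legw_def divide_simps add_nonneg_eq_0_iff)
  finally show ?thesis .
qed

lemma summable_legw_legm:
  assumes "x \<ge> 1 / 2"
  shows "summable (\<lambda>n. legw n * legm (2 * n) x)"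
  by (rule summable_comparison_test'[OF summable_mult[OF summable_cbin_pow4, of "2 * sqrt (2 * x) / x"], of 0])
     (use legw_legm_bound[OF assms] in auto)

text \<open>The termwise moment against \<open>u^(x - 1)\<close> of the Legendre series with
  coefficients \<open>legw n\<close>. Only even orders occur, so the sign between
  \<open>legm\<close> and the integral disappears.\<close>

definition leg :: "real \<Rightarrow> real" where
  "leg x = (\<Sum>n. legw n * legm (2 * n) x)"

lemma leg_sums: "x \<ge> 1 / 2 \<Longrightarrow> (\<lambda>n. legw n * legm (2 * n) x) sums leg x"
  unfolding leg_def by (rule summable_sums[OF summable_legw_legm])

definition leg_cert :: "real \<Rightarrow> nat \<Rightarrow> real" where
  "leg_cert x n = - 64 * (cbin n ^ 4 * legm (2 * n) x * real n ^ 4 * ((x + 2 * real n) / (x - 2 * real n)))"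

lemma legm_Suc_Suc:
  "legm (2 * Suc n) x = legm (2 * n) x * ((x - 2 * real n - 1) / (x + 2 * real n + 1)) *
     ((x - 2 * real n - 2) / (x + 2 * real n + 2))"
  by (simp add: legm_Suc algebra_simps)

text \<open>With \<open>x = m + 3/2\<close> the coefficients are those of \<open>corr_rec\<close>.
  Noninteger \<open>x\<close> keeps the denominators \<open>x - 2n\<close> and
  \<open>x - 2n - 2\<close> away from zero.\<close>

lemma leg_cert_diff:
  assumes "x > 1" and "\<And>k::nat. x \<noteq> real k"
  shows "(2 * x) ^ 3 * (legw n * legm (2 * n) (x + 1))
   - 2 * (2 * x - 1) * ((2 * x - 1) ^ 2 + 1) * (legw n * legm (2 * n) x)
   + (2 * x - 2) ^ 3 * (legw n * legm (2 * n) (x - 1)) = leg_cert x (Suc n) - leg_cert x n"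
proof -
  define N where "N = real n"
  have N0: "N \<ge> 0" by (simp add: N_def)
  have nz: "x - 2 * N \<noteq> 0" "x + 2 * N + 1 \<noteq> 0" "x - 2 * N - 2 \<noteq> 0" "x + 2 * N + 2 \<noteq> 0" "x - 1 \<noteq> 0" "N + 1 \<noteq> 0"
    using assms(2)[of "2 * n"] assms(2)[of "2 * n + 2"] assms(1) N0 by (auto simp: N_def)
  define L where "L = legm (2 * n) x"
  define c where "c = cbin n ^ 4"
  \<comment> \<open>Both neighbouring arguments become rational multiples of \<open>L\<close>, so
    the whole equation is rational in \<open>x\<close> and \<open>N\<close>.\<close>
  have up: "legm (2 * n) (x + 1) = L * x ^ 2 / ((x - 2 * N) * (x + 2 * N + 1))"
    using legm_shift[of x "2 * n"] nz assms(1) by (simp add: L_def N_def nonzero_eq_divide_eq)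
  have dn: "legm (2 * n) (x - 1) = L * ((x - 1 - 2 * N) * (x + 2 * N)) / (x - 1) ^ 2"
    using legm_shift[of "x - 1" "2 * n"] nz assms(1) by (simp add: L_def N_def nonzero_eq_divide_eq)
  have cs: "cbin (Suc n) ^ 4 = c * ((2 * N + 1) ^ 4 / (16 * (N + 1) ^ 4))"
  proof -
    have two: "2 * N + 2 = 2 * (N + 1)" by simp
    show ?thesis
      unfolding cbin_Suc c_def N_def[symmetric] power_mult_distrib power_divide unfolding two power_mult_distrib by simp
  qed
  have e1: "leg_cert x (Suc n) = - 64 * (c * L * ((2 * N + 1) ^ 4 / 16) * ((x - 2 * N - 1) / (x + 2 * N + 1)))"
  proof -
    have r: "real (Suc n) = N + 1" by (simp add: N_def)
    have r2: "x + 2 * (N + 1) = x + 2 * N + 2" "x - 2 * (N + 1) = x - 2 * N - 2" by simp_all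
    show ?thesis
      unfolding leg_cert_def legm_Suc_Suc cs r r2 L_def[symmetric] N_def[symmetric]
      using nz(3,4,6) by simp
  qed
  have e2: "leg_cert x n = - 64 * (c * L * N ^ 4 * ((x + 2 * N) / (x - 2 * N)))"
    unfolding leg_cert_def L_def c_def N_def by simp
  \<comment> \<open>These are the denominators left after all cancellations; the numerators are
    \<open>P - 1\<close> and \<open>Q - 1\<close>, so clearing \<open>P * Q\<close> produces a
    polynomial identity.\<close>
  define P Q where "P = x - 2 * N" and "Q = x + 2 * N + 1"
  have PQ: "P \<noteq> 0" "Q \<noteq> 0" using nz by (auto simp: P_def Q_def)
  define y where "y = x - 1"
  have y0: "y \<noteq> 0" using nz by (auto simp: y_def)
  have lhs: "P * Q * (u * (n1 * c * (L * k / (P * Q))) - v * (n1 * c * L) + (2 * y) ^ 3 * (n1 * c * (L * l / y ^ 2))) =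
      c * L * n1 * (u * k - v * (P * Q) + 8 * y * l * (P * Q))" for u v n1 k l
    using PQ y0 by (simp add: field_simps power2_eq_square power3_eq_cube)
  have rhs: "P * Q * (u * (c * L * v * (k / Q)) - u * (c * L * w * (l / P))) =
      c * L * (u * v * k * P - u * w * l * Q)" for u v w k l
    using PQ by (simp add: field_simps)
  have "(4 * N + 1) * ((2 * x) ^ 3 * x ^ 2 - 2 * (2 * x - 1) * ((2 * x - 1) ^ 2 + 1) * (P * Q)
     + 8 * y * ((P - 1) * (Q - 1)) * (P * Q)) =
     64 * N ^ 4 * (Q - 1) * Q - 4 * (2 * N + 1) ^ 4 * (P - 1) * P"
    unfolding P_def Q_def y_def by algebra
  then have "(4 * N + 1) * ((2 * x) ^ 3 * x ^ 2 - 2 * (2 * x - 1) * ((2 * x - 1) ^ 2 + 1) * (P * Q)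
     + 8 * y * ((P - 1) * (Q - 1)) * (P * Q)) =
     (- 64) * ((2 * N + 1) ^ 4 / 16) * (P - 1) * P - (- 64) * N ^ 4 * (Q - 1) * Q"
    by simp
  then have "P * Q * ((2 * x) ^ 3 * ((4 * N + 1) * c * (L * x ^ 2 / (P * Q)))
   - 2 * (2 * x - 1) * ((2 * x - 1) ^ 2 + 1) * ((4 * N + 1) * c * L)
   + (2 * y) ^ 3 * ((4 * N + 1) * c * (L * ((P - 1) * (Q - 1)) / y ^ 2))) =
    P * Q * (- 64 * (c * L * ((2 * N + 1) ^ 4 / 16) * ((P - 1) / Q)) -
      - 64 * (c * L * N ^ 4 * ((Q - 1) / P)))"
    unfolding lhs rhs by (simp only: mult.assoc)
  then have *: "(2 * x) ^ 3 * ((4 * N + 1) * c * (L * x ^ 2 / (P * Q)))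
   - 2 * (2 * x - 1) * ((2 * x - 1) ^ 2 + 1) * ((4 * N + 1) * c * L)
   + (2 * y) ^ 3 * ((4 * N + 1) * c * (L * ((P - 1) * (Q - 1)) / y ^ 2)) =
    - 64 * (c * L * ((2 * N + 1) ^ 4 / 16) * ((P - 1) / Q)) - - 64 * (c * L * N ^ 4 * ((Q - 1) / P))"
    using PQ by (simp only: mult_left_cancel[of "P * Q"] mult_eq_0_iff de_Morgan_disj simp_thms)
  have r: "x + 2 * N + 1 - 1 = x + 2 * N" "2 * (x - 1) = 2 * x - 2" "x - 2 * N - 1 = x - 1 - 2 * N"
    by simp_all
  show ?thesis
    using * unfolding P_def Q_def y_def e1 e2 up dn legw_def c_def[symmetric] L_def[symmetric] N_def[symmetric] r .
qed

lemma legm_tendsto_0: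
  assumes "x \<ge> 1 / 2"
  shows "(\<lambda>n. legm (2 * n) x) \<longlonglongrightarrow> 0"
proof (rule tendsto_0_le)
  show "(\<lambda>n. 2 * sqrt (2 * x) / x * (1 / (4 * real n + 1))) \<longlonglongrightarrow> 0"
    by (rule tendsto_mult_right_zero) real_asymp
  show "\<forall>\<^sub>F n in sequentially. norm (legm (2 * n) x) \<le> norm (2 * sqrt (2 * x) / x * (1 / (4 * real n + 1))) * 1"
    using legm_bound[OF assms, of "2 * _"] assms by (auto simp: abs_mult abs_divide)
qed

text \<open>The factor \<open>n^4 cbin n ^ 4\<close> grows like \<open>n^2\<close>, and
  \<open>legm_bound\<close> at \<open>x\<close> gives too little decay. Shifting to
  \<open>x - 1\<close> gains a rational factor of order \<open>n^(-2)\<close>, after which the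
  moment at \<open>x - 1 \<ge> 1/2\<close> only has to tend to 0.\<close>

lemma leg_cert_lim:
  assumes "x \<ge> 3 / 2" and "\<And>k::nat. x \<noteq> real k"
  shows "leg_cert x \<longlonglongrightarrow> 0"
proof -
  have eq: "leg_cert x n = (real n * cbin n ^ 2) ^ 2 * legm (2 * n) (x - 1) *
      (- 64 * (x - 1) ^ 2 * (real n ^ 2 / ((2 * real n + 1 - x) * (2 * real n - x))))" for n
  proof -
    have nz: "x - 1 - 2 * real n \<noteq> 0" "x + 2 * real n \<noteq> 0" "x - 2 * real n \<noteq> 0"
      using assms(1) assms(2)[of "2 * n"] assms(2)[of "2 * n + 1"] by auto
    have "legm (2 * n) x * ((x - 1 - 2 * real n) * (x + 2 * real n)) = legm (2 * n) (x - 1) * (x - 1) ^ 2"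
      using legm_shift[of "x - 1" "2 * n"] assms(1) by simp
    then have "legm (2 * n) x = legm (2 * n) (x - 1) * (x - 1) ^ 2 / ((x - 1 - 2 * real n) * (x + 2 * real n))"
      using nz by (simp add: nonzero_eq_divide_eq)
    moreover have "(2 * real n + 1 - x) * (2 * real n - x) = (x - 1 - 2 * real n) * (x - 2 * real n)"
      by (simp add: algebra_simps)
    ultimately show ?thesis
      unfolding leg_cert_def using nz by (simp add: divide_simps power_mult_distrib)
        (simp add: power2_eq_square power4_eq_xxxx mult_ac)
  qed
  have lim: "(\<lambda>n. (real n * cbin n ^ 2) ^ 2 * legm (2 * n) (x - 1) *
      (- 64 * (x - 1) ^ 2 * (real n ^ 2 / ((2 * real n + 1 - x) * (2 * real n - x))))) \<longlonglongrightarrow>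
      (1 / pi) ^ 2 * 0 * (- 64 * (x - 1) ^ 2 * (1 / 4))"
  proof (intro tendsto_mult tendsto_power cbin_sq_asymp tendsto_const)
    show "(\<lambda>n. legm (2 * n) (x - 1)) \<longlonglongrightarrow> 0"
      by (rule legm_tendsto_0) (use assms(1) in simp)
    show "(\<lambda>n. real n ^ 2 / ((2 * real n + 1 - x) * (2 * real n - x))) \<longlonglongrightarrow> 1 / 4"
      by real_asymp
  qed
  have "leg_cert x \<longlonglongrightarrow> (1 / pi) ^ 2 * 0 * (- 64 * (x - 1) ^ 2 * (1 / 4))"
    by (rule Lim_transform_eventually[OF lim], rule always_eventually, rule allI, rule eq[symmetric])
  then show ?thesis by simp
qed

lemma half_not_nat: "real m + 1 / 2 \<noteq> real k"
proof
  assume "real m + 1 / 2 = real k"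
  then have "real (2 * m + 1) = real (2 * k)" by simp
  then have "2 * m + 1 = 2 * k" by (simp only: of_nat_eq_iff)
  then show False by presburger
qed

lemma leg_rec:
  assumes "x \<ge> 3 / 2" and "\<And>k::nat. x \<noteq> real k"
  shows "(2 * x) ^ 3 * leg (x + 1) - 2 * (2 * x - 1) * ((2 * x - 1) ^ 2 + 1) * leg x
    + (2 * x - 2) ^ 3 * leg (x - 1) = 0"
proof -
  have "(\<lambda>n. leg_cert x (Suc n) - leg_cert x n) sums (0 - leg_cert x 0)"
    by (rule telescope_sums[OF leg_cert_lim[OF assms]])
  moreover have "(\<lambda>n. leg_cert x (Suc n) - leg_cert x n) sums ((2 * x) ^ 3 * leg (x + 1)
    - 2 * (2 * x - 1) * ((2 * x - 1) ^ 2 + 1) * leg x + (2 * x - 2) ^ 3 * leg (x - 1))"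
    by (subst leg_cert_diff[OF _ assms(2), symmetric])
       (use assms in \<open>auto intro!: sums_add sums_diff sums_mult leg_sums\<close>)
  moreover have "leg_cert x 0 = 0"
    by (simp add: leg_cert_def)
  ultimately show ?thesis
    using sums_unique2 by fastforce
qed

text \<open>At \<open>x = 1/2\<close> the factors are \<open>- (2j - 1) / (2j + 1)\<close>: the
  product telescopes, and an even number of factors removes the sign.\<close>

lemma legm_half: "legm (2 * n) (1 / 2) = 2 / (4 * real n + 1)"
proof (induction n)
  case (Suc n)
  define p q t where "p = 4 * real n + 1" and "q = 4 * real n + 3" and "t = 4 * real (Suc n) + 1"
  have "1 / 2 - 2 * real n - 1 = - p / 2" "1 / 2 + 2 * real n + 1 = q / 2"
    "1 / 2 - 2 * real n - 2 = - q / 2" "1 / 2 + 2 * real n + 2 = t / 2"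
    by (simp_all add: p_def q_def t_def field_simps)
  then have "legm (2 * Suc n) (1 / 2) = 2 / p * ((- p / 2) / (q / 2)) * ((- q / 2) / (t / 2))"
    unfolding legm_Suc_Suc Suc by (simp only: p_def)
  also have "p \<noteq> 0" "q \<noteq> 0" by (simp_all add: p_def q_def add_nonneg_eq_0_iff)
  then have "2 / p * ((- p / 2) / (q / 2)) * ((- q / 2) / (t / 2)) = 2 / t"
    by simp
  finally show ?case unfolding t_def .
qed simp

lemma legm_three_halves: "legm (2 * n) (3 / 2) = 2 / ((4 * real n + 1) * (1 - 4 * real n) * (4 * real n + 3))"
proof -
  have nz: "1 - 4 * real n \<noteq> 0" using half_not_nat[of 0 "2 * n"] by auto
  have p: "4 * real n + 1 > 0" "4 * real n + 3 > 0" by auto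
  have th: "3 / 2 = 1 / 2 + (1 :: real)" by simp
  have "legm (2 * n) (3 / 2) * ((1 / 2 - real (2 * n)) * (1 / 2 + real (2 * n) + 1)) = 2 / (4 * real n + 1) * (1 / 2) ^ 2"
    unfolding legm_half[symmetric] th by (rule legm_shift) simp
  moreover have "(1 / 2 - real (2 * n)) * (1 / 2 + real (2 * n) + 1) = (1 - 4 * real n) * (4 * real n + 3) / 4"
    by (simp add: field_simps)
  ultimately have "legm (2 * n) (3 / 2) * ((1 - 4 * real n) * (4 * real n + 3) / 4) = 2 / (4 * real n + 1) * (1 / 2) ^ 2"
    by (simp only:)
  moreover have "L * (u / 4) = 2 / p * (1 / 2) ^ 2 \<Longrightarrow> L * u = 2 / p" for L u p :: real
    by (simp add: power2_eq_square)
  ultimately have "legm (2 * n) (3 / 2) * ((1 - 4 * real n) * (4 * real n + 3)) = 2 / (4 * real n + 1)"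
    by blast
  moreover have "(1 - 4 * real n) * (4 * real n + 3) \<noteq> 0"
    using nz p by simp
  ultimately show ?thesis
    by (metis divide_divide_eq_left mult.assoc nonzero_mult_div_cancel_right)
qed

text \<open>First initial value. The moment \<open>2 / (4n + 1)\<close> cancels the weight, so the
  two series agree term by term.\<close>

lemma leg_half: "leg (1 / 2) = 2 * corr 0"
proof -
  have "(\<lambda>n. 2 * (cbin n ^ 2 * cbin (n + 0) ^ 2)) sums (2 * corr 0)"
    by (intro sums_mult corr_sums)
  moreover have "legw n * legm (2 * n) (1 / 2) = 2 * (cbin n ^ 2 * cbin (n + 0) ^ 2)" for n
    unfolding legw_def legm_half by (simp add: add_nonneg_eq_0_iff flip: power_add)
  ultimately show ?thesis
    using leg_sums[of "1 / 2"] by (simp add: sums_unique2)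
qed

text \<open>Second initial value. The terms now differ, but their difference telescopes with
  \<open>Y\<close>, which vanishes at 0 and at infinity.\<close>

lemma leg_three_halves: "leg (3 / 2) = 2 * corr 1"
proof -
  define Y where "Y n = - 8 * real n ^ 2 * cbin n ^ 4 / (4 * real n - 1)" for n
  have d: "2 * (cbin n ^ 2 * cbin (n + 1) ^ 2) - legw n * legm (2 * n) (3 / 2) = Y (Suc n) - Y n" for n
  proof -
    define r c where "r = real n" and "c = cbin n"
    have nz: "4 * r - 1 \<noteq> 0" using half_not_nat[of 0 "2 * n"] by (auto simp: r_def)
    have nz2: "4 * r + 1 \<noteq> 0" "4 * r + 3 \<noteq> 0" "r + 1 \<noteq> 0" by (simp_all add: r_def add_nonneg_eq_0_iff)
    define p q t where "p = 4 * r - 1" and "q = 4 * r + 3" and "t = r + 1"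
    have cs: "cbin (Suc n) = c * ((2 * r + 1) / (2 * t))"
      by (simp add: cbin_Suc c_def r_def t_def algebra_simps)
    have lw: "legw n * legm (2 * n) (3 / 2) = - 2 * c ^ 4 / (p * q)"
    proof -
      have "legw n * legm (2 * n) (3 / 2) = (4 * r + 1) * c ^ 4 * (2 / ((4 * r + 1) * (- p) * q))"
        unfolding legw_def legm_three_halves by (simp add: r_def c_def p_def q_def)
      then show ?thesis using nz2(1) by simp
    qed
    have YS: "Y (Suc n) = - 8 * t ^ 2 * (c * ((2 * r + 1) / (2 * t))) ^ 4 / q"
      unfolding Y_def cs by (simp add: t_def r_def q_def add.commute)
    have YN: "Y n = - 8 * r ^ 2 * c ^ 4 / p"
      by (simp add: Y_def r_def c_def p_def)
    have nz3: "p \<noteq> 0" "q \<noteq> 0" "t \<noteq> 0" using nz nz2 by (auto simp: p_def q_def t_def)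
    have "2 * t ^ 2 * p * q * (2 * (c ^ 2 * (c * (k / (2 * t))) ^ 2) - - 2 * c ^ 4 / (p * q)) =
        c ^ 4 * (k ^ 2 * p * q + 4 * t ^ 2)" for k
      using nz3 by (simp add: field_simps power2_eq_square power4_eq_xxxx)
    moreover have "2 * t ^ 2 * p * q * (- 8 * t ^ 2 * (c * (k / (2 * t))) ^ 4 / q - - 8 * r ^ 2 * c ^ 4 / p) =
        c ^ 4 * (16 * r ^ 2 * t ^ 2 * q - k ^ 4 * p)" for k
      using nz3 by (simp add: field_simps power2_eq_square power4_eq_xxxx)
    moreover have "(2 * r + 1) ^ 2 * p * q + 4 * t ^ 2 = 16 * r ^ 2 * t ^ 2 * q - (2 * r + 1) ^ 4 * p"
      unfolding p_def q_def t_def by algebra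
    ultimately have "2 * t ^ 2 * p * q * (2 * (c ^ 2 * (c * ((2 * r + 1) / (2 * t))) ^ 2) - - 2 * c ^ 4 / (p * q)) =
      2 * t ^ 2 * p * q * (- 8 * t ^ 2 * (c * ((2 * r + 1) / (2 * t))) ^ 4 / q - - 8 * r ^ 2 * c ^ 4 / p)"
      by (simp only:)
    moreover have "2 * t ^ 2 * p * q \<noteq> 0" using nz3 by simp
    ultimately show ?thesis
      unfolding lw YS YN Suc_eq_plus1[symmetric] cs c_def[symmetric] using mult_left_cancel by blast
  qed
  have "Y \<longlonglongrightarrow> 0"
  proof -
    have "(\<lambda>n. (real n * cbin n ^ 2) ^ 2 * (- 8 / (4 * real n - 1))) \<longlonglongrightarrow> (1 / pi) ^ 2 * 0"
      by (intro tendsto_mult tendsto_power cbin_sq_asymp) real_asymp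
    moreover have "(real n * cbin n ^ 2) ^ 2 * (- 8 / (4 * real n - 1)) = Y n" for n
      by (simp add: Y_def power_mult_distrib)
    ultimately show ?thesis by simp
  qed
  from telescope_sums[OF this] have "(\<lambda>n. Y (Suc n) - Y n) sums (0 - Y 0)" .
  moreover have "(\<lambda>n. Y (Suc n) - Y n) sums (2 * corr 1 - leg (3 / 2))"
    unfolding d[symmetric] by (intro sums_diff sums_mult corr_sums leg_sums) simp
  moreover have "Y 0 = 0" by (simp add: Y_def)
  ultimately show ?thesis
    using sums_unique2 by fastforce
qed

text \<open>Two initial values suffice for the second-order recurrence, since its leading
  coefficient \<open>(2k + 3)^3\<close> is nonzero.\<close>

lemma corr_eq_leg: "leg (real m + 1 / 2) = 2 * corr m"
proof (induction m rule: nat_less_induct)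
  case (1 m)
  consider "m = 0" | "m = 1" | k where "m = k + 2"
    by (metis One_nat_def add_2_eq_Suc' not0_implies_Suc)
  then show ?case
  proof cases
    case 3
    define x where "x = real k + 3 / 2"
    have "x \<noteq> real j" for j :: nat
      using half_not_nat[of "k + 1" j] by (simp add: x_def)
    then have "(2 * x) ^ 3 * leg (x + 1) - 2 * (2 * x - 1) * ((2 * x - 1) ^ 2 + 1) * leg x
      + (2 * x - 2) ^ 3 * leg (x - 1) = 0"
      by (intro leg_rec) (simp_all add: x_def)
    moreover have "2 * x = 2 * real k + 3" "2 * x - 1 = 2 * (real k + 1)" "2 * x - 2 = 2 * real k + 1"
      by (simp_all add: x_def)
    moreover have "leg x = 2 * corr (k + 1)" "leg (x - 1) = 2 * corr k"
    proof -
      have x: "x = real (k + 1) + 1 / 2" "x - 1 = real k + 1 / 2" by (simp_all add: x_def)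
      show "leg x = 2 * corr (k + 1)" unfolding x(1) by (rule 1[rule_format]) (use 3 in simp)
      show "leg (x - 1) = 2 * corr k" unfolding x(2) by (rule 1[rule_format]) (use 3 in simp)
    qed
    ultimately have "(2 * real k + 3) ^ 3 * leg (x + 1) - 2 * (2 * (real k + 1)) * ((2 * (real k + 1)) ^ 2 + 1) * (2 * corr (k + 1))
      + (2 * real k + 1) ^ 3 * (2 * corr k) = 0" by (simp only:)
    then have "(2 * real k + 3) ^ 3 * (leg (x + 1) - 2 * corr (k + 2)) = 0"
      using corr_rec[of k] by algebra
    then have "leg (x + 1) = 2 * corr (k + 2)"
      by (simp add: add_nonneg_eq_0_iff)
    then show ?thesis using 3 by (simp add: x_def)
  qed (use leg_half leg_three_halves in simp_all)
qed

subsection \<open>Interchange of double series\<close>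

text \<open>Tonelli: for nonnegative terms the iterated sum already gives unconditional summability
  over all pairs.\<close>

lemma has_sum_nonneg_rows:
  fixes u :: "nat \<Rightarrow> nat \<Rightarrow> real"
  assumes nn: "\<And>i j. u i j \<ge> 0" and rows: "\<And>i. u i sums r i" and S: "r sums S"
  shows "((\<lambda>(i, j). u i j) has_sum S) UNIV"
proof -
  have row: "(u i has_sum r i) UNIV" for i
    by (rule sums_nonneg_imp_has_sum[OF rows nn])
  have r0: "r i \<ge> 0" for i
    using has_sum_nonneg[OF row[of i]] nn by auto
  have "(r has_sum S) UNIV"
    by (rule sums_nonneg_imp_has_sum[OF S r0])
  moreover have "(\<lambda>x. norm ((\<lambda>(i, j). u i j) x)) summable_on (UNIV \<times> UNIV)"
    unfolding Infinite_Sum.abs_summable_on_Sigma_iff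
  proof (intro conjI ballI)
    show "(\<lambda>j. norm (case (i, j) of (i, j) \<Rightarrow> u i j)) summable_on UNIV" for i
      using row[of i] nn by (auto simp: summable_on_def)
    have "infsum (u i) UNIV = r i" for i
      by (rule infsumI[OF row])
    then show "(\<lambda>i. norm (\<Sum>\<^sub>\<infinity>j. norm (case (i, j) of (i, j) \<Rightarrow> u i j))) summable_on UNIV"
      using \<open>(r has_sum S) UNIV\<close> nn r0 by (auto simp: summable_on_def)
  qed
  then have "(\<lambda>(i, j). u i j) summable_on (UNIV \<times> UNIV)"
    by (rule Infinite_Sum.abs_summable_summable)
  ultimately have "((\<lambda>(i, j). u i j) has_sum S) (UNIV \<times> UNIV)"
    by (intro has_sum_SigmaI[where g = r]) (simp_all add: row)
  then show ?thesis by simp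
qed

lemma has_sum_rows_sums:
  fixes u :: "nat \<Rightarrow> nat \<Rightarrow> real"
  assumes u: "((\<lambda>(i, j). u i j) has_sum S) UNIV" and rows: "\<And>i. u i sums r i"
  shows "r sums S"
proof -
  have u': "((\<lambda>(i, j). u i j) has_sum S) (UNIV \<times> UNIV)" using u by simp
  have "(u i has_sum r i) UNIV" for i
  proof -
    have "u i summable_on UNIV"
      by (rule summable_on_SigmaD1[of u UNIV "\<lambda>_. UNIV"]) (use u' in \<open>auto simp: summable_on_def\<close>)
    then obtain x where "(u i has_sum x) UNIV" by (auto simp: summable_on_def)
    with rows[of i] show ?thesis
      using has_sum_imp_sums sums_unique2 by metis
  qed
  then have "(r has_sum S) UNIV"
    by (intro has_sum_SigmaD[OF u']) auto
  then show ?thesis by (rule has_sum_imp_sums)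
qed

lemma has_sum_columns_sums:
  fixes u :: "nat \<Rightarrow> nat \<Rightarrow> real"
  assumes u: "((\<lambda>(i, j). u i j) has_sum S) UNIV" and columns: "\<And>j. (\<lambda>i. u i j) sums c j"
  shows "c sums S"
proof (rule has_sum_rows_sums[where u = "\<lambda>j i. u i j"])
  have "((\<lambda>(i, j). u i j) has_sum S) (UNIV \<times> UNIV)" using u by simp
  then show "((\<lambda>(j, i). u i j) has_sum S) UNIV"
    by (subst (asm) has_sum_swap) simp
qed (rule columns)

lemma sums_swap_nonneg:
  fixes u :: "nat \<Rightarrow> nat \<Rightarrow> real"
  assumes "\<And>i j. u i j \<ge> 0" "\<And>i. u i sums r i" "r sums S" "\<And>j. (\<lambda>i. u i j) sums c j"
  shows "c sums S"
  by (rule has_sum_columns_sums[OF has_sum_nonneg_rows[OF assms(1-3)] assms(4)])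

text \<open>Fubini with a product majorant. The common value stays existential because it is
  computed only later, from either side.\<close>

lemma sums_swap_dominated:
  fixes u :: "nat \<Rightarrow> nat \<Rightarrow> real"
  assumes A: "summable A" and B: "summable B" and B0: "\<And>j. B j \<ge> 0"
    and bound: "\<And>i j. \<bar>u i j\<bar> \<le> A i * B j"
    and rows: "\<And>i. u i sums r i" and columns: "\<And>j. (\<lambda>i. u i j) sums c j"
  shows "\<exists>S. r sums S \<and> c sums S"
proof -
  have "((\<lambda>(i, j). \<bar>A i * B j\<bar>) has_sum (\<Sum>i. \<bar>A i\<bar> * suminf B)) UNIV"
  proof (rule has_sum_nonneg_rows)
    have "\<bar>A i\<bar> * B j = \<bar>A i * B j\<bar>" for i j using B0 by (simp add: abs_mult)
    then show "(\<lambda>j. \<bar>A i * B j\<bar>) sums (\<bar>A i\<bar> * suminf B)" for i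
      using sums_mult[OF summable_sums[OF B], of "\<bar>A i\<bar>"] by simp
    \<comment> \<open>Nonnegativity of \<open>A\<close> is not assumed: one positive
      \<open>B j\<close> forces it through the bound, and otherwise \<open>B\<close> is identically
      zero.\<close>
    have "summable (\<lambda>i. \<bar>A i\<bar> * suminf B)"
    proof (cases "\<forall>j. B j = 0")
      case True
      then have "B = (\<lambda>_. 0)" by auto
      then show ?thesis by simp
    next
      case False
      then obtain j where "B j > 0" using B0 less_eq_real_def by metis
      then have "A i \<ge> 0" for i
        using bound[of i j] by (metis abs_ge_zero order_trans zero_le_mult_iff not_le)
      then show ?thesis using A by (intro summable_mult2) simp
    qed
    then show "(\<lambda>i. \<bar>A i\<bar> * suminf B) sums (\<Sum>i. \<bar>A i\<bar> * suminf B)"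
      by (rule summable_sums)
  qed simp
  then have "(\<lambda>x. norm ((\<lambda>(i, j). A i * B j) x)) summable_on UNIV"
    by (auto simp: summable_on_def case_prod_unfold)
  then have "(\<lambda>x. norm ((\<lambda>(i, j). u i j) x)) summable_on UNIV"
    by (rule Infinite_Sum.abs_summable_on_comparison_test) (use order_trans[OF bound abs_ge_self] in auto)
  from Infinite_Sum.abs_summable_summable[OF this] obtain S where S: "((\<lambda>(i, j). u i j) has_sum S) UNIV"
    by (auto simp: summable_on_def)
  show ?thesis
    using has_sum_rows_sums[OF S rows] has_sum_columns_sums[OF S columns] by auto
qed

subsection \<open>Summation over the moments\<close>

lemma legm_at_top: "(\<lambda>m. (real m + 1 / 2) * legm N (real m + 1 / 2)) \<longlonglongrightarrow> 1"
proof (induction N)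
  case (Suc N)
  have "(\<lambda>m. (real m + 1 / 2 - real N - 1) / (real m + 1 / 2 + real N + 1)) \<longlonglongrightarrow> 1"
    by real_asymp
  from tendsto_mult[OF Suc this] show ?case
    by (simp add: legm_Suc mult.assoc)
qed (simp add: add_nonneg_eq_0_iff)

definition odd_tail :: "nat \<Rightarrow> real" where
  "odd_tail n = (\<Sum>j. 1 / (2 * real (j + n) + 1) ^ 2)"

lemma odd_tail_sums: "(\<lambda>j. 1 / (2 * real (j + n) + 1) ^ 2) sums odd_tail n"
  using summable_ignore_initial_segment[OF summable_inverse_odd_power[of 2], of n]
  unfolding odd_tail_def by (auto simp: summable_sums)

lemma odd_tail_Suc: "odd_tail n = 1 / (2 * real n + 1) ^ 2 + odd_tail (Suc n)"
  using suminf_split_head[OF sums_summable[OF odd_tail_sums[of n]]]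
  by (simp add: odd_tail_def add_ac)

text \<open>The difference of consecutive even orders, unlike a single order, telescopes in
  \<open>m\<close>. The certificate \<open>D\<close> uses the odd order in between and tends to 1 by
  \<open>legm_at_top\<close>.\<close>

lemma legm_diff_sums:
  "(\<lambda>m. legm (2 * n) (real m + 1 / 2) / (2 * real m + 1) - legm (2 * Suc n) (real m + 1 / 2) / (2 * real m + 1))
    sums (2 / (2 * real n + 1) ^ 2)"
proof -
  define A where "A = 2 * real n + 1"
  define B where "B = A * (A + 1)"
  have A: "A > 0" and B: "B > 0" by (auto simp: A_def B_def)
  define D where "D m = legm (Suc (2 * n)) (real m + 1 / 2) * (real m + 1 / 2 + B)" for m
  have step: "legm (2 * n) (real m + 1 / 2) / (2 * real m + 1) - legm (2 * Suc n) (real m + 1 / 2) / (2 * real m + 1) =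
     (2 * A + 1) / B ^ 2 * (D (Suc m) - D m)" for m
  proof -
    define x where "x = real m + 1 / 2"
    have x: "x > 0" by (simp add: x_def)
    define L where "L = legm (2 * n) x"
    define p q where "p = x + A" and "q = x + A + 1"
    have pq: "p > 0" "q > 0" using x A by (auto simp: p_def q_def)
    have s: "legm (2 * n) (x + 1) * ((x - A + 1) * p) = L * x ^ 2"
      using legm_shift[OF x, of "2 * n"] by (simp add: L_def p_def A_def algebra_simps)
    have "D (Suc m) = legm (2 * n) (x + 1) * ((x - A + 1) / q) * (x + 1 + B)"
      by (simp add: D_def legm_Suc x_def A_def q_def algebra_simps)
    also have "legm (2 * n) (x + 1) * ((x - A + 1) / q) = L * x ^ 2 / (p * q)"
    proof -
      have "l * (k * p) = M \<Longrightarrow> l * (k / q) = M / (p * q)" for l k M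
        using pq by (auto simp: field_simps)
      from this[OF s] show ?thesis .
    qed
    finally have D1: "D (Suc m) = L * x ^ 2 / (p * q) * (x + 1 + B)" .
    have D0: "D m = L * ((x - A) / p) * (x + B)"
      by (simp add: D_def legm_Suc x_def[symmetric] L_def A_def p_def algebra_simps)
    have l2: "legm (2 * Suc n) x = L * ((x - A) / p) * ((x - A - 1) / q)"
      unfolding legm_Suc_Suc by (simp add: L_def A_def p_def q_def algebra_simps)
    have "L / (2 * x) - L * (k / p) * (l / q) / (2 * x) = L * (p * q - k * l) / (2 * x * p * q)" for k l
      using pq x by (simp add: field_simps)
    then have "L / (2 * x) - L * ((x - A) / p) * ((x - A - 1) / q) / (2 * x) =
        L * (p * q - (x - A) * (x - A - 1)) / (2 * x * p * q)" .
    \<comment> \<open>The factor \<open>2x\<close> is the weight \<open>2m + 1\<close>, which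
      therefore cancels.\<close>
    also have "p * q - (x - A) * (x - A - 1) = 2 * x * (2 * A + 1)"
      by (simp add: p_def q_def algebra_simps)
    also have "L * (2 * x * (2 * A + 1)) / (2 * x * p * q) = (2 * A + 1) * L / (p * q)"
      using x by simp
    finally have 1: "L / (2 * x) - L * ((x - A) / p) * ((x - A - 1) / q) / (2 * x) = (2 * A + 1) * L / (p * q)" .
    have "L * x ^ 2 / (p * q) * k - L * ((x - A) / p) * l = L * (x ^ 2 * k - (x - A) * q * l) / (p * q)" for k l
      using pq by (simp add: field_simps)
    then have "D (Suc m) - D m = L * (x ^ 2 * (x + 1 + B) - (x - A) * q * (x + B)) / (p * q)"
      unfolding D0 D1 .
    \<comment> \<open>\<open>B = A(A + 1)\<close> is chosen for this:
      \<open>(x - A)(x + A + 1) = x^2 + x - B\<close>, so all powers of \<open>x\<close> drop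
      out.\<close>
    also have "x ^ 2 * (x + 1 + B) - (x - A) * q * (x + B) = B ^ 2"
      unfolding q_def B_def by algebra
    finally have 2: "D (Suc m) - D m = L * B ^ 2 / (p * q)" .
    have "2 * real m + 1 = 2 * x" by (simp add: x_def)
    then show ?thesis
      unfolding x_def[symmetric] l2 2 L_def[symmetric] using 1 B by simp
  qed
  have "(\<lambda>m. (real m + 1 / 2) * legm (Suc (2 * n)) (real m + 1 / 2) * ((real m + 1 / 2 + B) / (real m + 1 / 2))) \<longlonglongrightarrow> 1 * 1"
    by (intro tendsto_mult legm_at_top) real_asymp
  moreover have "(real m + 1 / 2) * legm (Suc (2 * n)) (real m + 1 / 2) * ((real m + 1 / 2 + B) / (real m + 1 / 2)) = D m" for m
    by (simp add: D_def add_nonneg_eq_0_iff)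
  ultimately have "D \<longlonglongrightarrow> 1" by simp
  then have "(\<lambda>m. (2 * A + 1) / B ^ 2 * (D (Suc m) - D m)) sums ((2 * A + 1) / B ^ 2 * (1 - D 0))"
    by (intro sums_mult telescope_sums)
  moreover have "(2 * A + 1) / B ^ 2 * (1 - D 0) = 2 / A ^ 2"
  proof -
    define s t where "s = 2 * A - 1" and "t = 2 * A + 1"
    have st: "s > 0" "t > 0" using A by (auto simp: s_def t_def A_def)
    have "4 * real n + 1 = s" "1 / 2 - real (2 * n) - 1 = - (s / 2)" "1 / 2 + real (2 * n) + 1 = t / 2"
      by (simp_all add: s_def t_def A_def field_simps)
    moreover have "D 0 = legm (2 * n) (1 / 2) * ((1 / 2 - real (2 * n) - 1) / (1 / 2 + real (2 * n) + 1)) * (1 / 2 + B)"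
      by (simp add: D_def legm_Suc)
    ultimately have "D 0 = 2 / s * (- (s / 2) / (t / 2)) * (1 / 2 + B)"
      unfolding legm_half by (simp only:)
    also have "\<dots> = - (1 + 2 * B) / t"
      using st by (simp add: field_simps)
    finally have "1 - D 0 = 2 * (A + 1) ^ 2 / t"
      using st by (simp add: divide_simps) (simp add: t_def B_def power2_eq_square algebra_simps)
    then show ?thesis
      unfolding t_def[symmetric] using st A by (simp add: B_def power_mult_distrib)
  qed
  ultimately show ?thesis
    unfolding step A_def[symmetric] by simp
qed

lemma legm_weighted_sums: "(\<lambda>m. legm (2 * n) (real m + 1 / 2) / (2 * real m + 1)) sums (2 * odd_tail n)"
proof (induction n)
  case 0
  have "(\<lambda>m. 2 * (1 / (2 * real (m + 0) + 1) ^ 2)) sums (2 * odd_tail 0)"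
    by (intro sums_mult odd_tail_sums)
  moreover have "2 * (1 / (2 * real (m + 0) + 1) ^ 2) = legm (2 * 0) (real m + 1 / 2) / (2 * real m + 1)" for m
    by (simp add: field_simps power2_eq_square)
  ultimately show ?case by (simp only:)
next
  case (Suc n)
  have "2 * odd_tail n - 2 / (2 * real n + 1) ^ 2 = 2 * odd_tail (Suc n)"
    unfolding odd_tail_Suc[of n] by simp
  with sums_diff[OF Suc legm_diff_sums[of n]] show ?case by simp
qed

text \<open>For \<open>n > 0\<close> the terms telescope with \<open>x * legm (2 * n) x\<close>. The
  telescoping constant has \<open>N(N + 1)\<close> in its denominator, so \<open>n = 0\<close> is
  treated apart by partial fractions.\<close>

lemma legm_shifted_weighted_sums:
  "(\<lambda>m. legm (2 * n) (real (m + 1) + 1 / 2) / (2 * real m + 1)) sums (1 / ((4 * real n + 1) * (2 * real n + 1)))"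
proof (cases "n = 0")
  case True
  define f where "f m = - 1 / (2 * real m + 1)" for m
  have "f \<longlonglongrightarrow> 0" unfolding f_def by real_asymp
  then have "(\<lambda>m. f (Suc m) - f m) sums (0 - f 0)" by (rule telescope_sums)
  moreover have "f (Suc m) - f m = legm 0 (real (m + 1) + 1 / 2) / (2 * real m + 1)" for m
    by (simp add: f_def divide_simps add_nonneg_eq_0_iff)
  ultimately show ?thesis using True by (simp add: f_def)
next
  case False
  define N where "N = 2 * real n"
  have N: "N > 0" using False by (simp add: N_def)
  define D where "D m = (real m + 1 / 2) * legm (2 * n) (real m + 1 / 2)" for m
  have step: "legm (2 * n) (real (m + 1) + 1 / 2) / (2 * real m + 1) = 1 / (2 * (N * (N + 1))) * (D (Suc m) - D m)" for m
  proof -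
    define x where "x = real m + 1 / 2"
    have x: "x > 0" by (simp add: x_def)
    define L where "L = legm (2 * n) (x + 1)"
    have "L * ((x - N) * (x + N + 1)) = legm (2 * n) x * x ^ 2"
      using legm_shift[OF x, of "2 * n"] by (simp add: L_def N_def)
    then have "legm (2 * n) x = L * ((x - N) * (x + N + 1)) / x ^ 2"
      using x by (simp add: nonzero_eq_divide_eq)
    then have D0: "D m = L * ((x - N) * (x + N + 1)) / x"
      by (simp add: D_def x_def[symmetric] power2_eq_square)
    have "D (Suc m) - D m = (x + 1) * L - L * ((x - N) * (x + N + 1)) / x"
      unfolding D0 by (simp add: D_def L_def x_def algebra_simps)
    also have "\<dots> = L * (N * (N + 1)) / x"
      using x by (simp add: field_simps)
    finally have "D (Suc m) - D m = L * (N * (N + 1)) / x" .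
    then have "1 / (2 * (N * (N + 1))) * (D (Suc m) - D m) = L / (2 * x)"
      using N by simp
    then show ?thesis by (simp add: L_def x_def add_ac)
  qed
  have "D \<longlonglongrightarrow> 1" unfolding D_def by (rule legm_at_top)
  then have "(\<lambda>m. 1 / (2 * (N * (N + 1))) * (D (Suc m) - D m)) sums (1 / (2 * (N * (N + 1))) * (1 - D 0))"
    by (intro sums_mult telescope_sums)
  moreover have "D 0 = 1 / (2 * N + 1)"
    by (simp add: D_def legm_half N_def)
  then have "1 - D 0 = 2 * N / (2 * N + 1)"
    using N by (simp add: field_simps)
  then have "1 / (2 * (N * (N + 1))) * (1 - D 0) = 1 / ((2 * N + 1) * (N + 1))"
    using N by simp
  ultimately show ?thesis
    unfolding step by (simp add: N_def)
qed

text \<open>A product of a function of \<open>n\<close> and one of \<open>m\<close>, as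
  \<open>sums_swap_dominated\<close> requires; dividing by \<open>2m + 1\<close> makes the second
  factor summable.\<close>

lemma legw_legm_bound_half: 
  "\<bar>legw n * legm (2 * n) (real m + 1 / 2)\<bar> \<le> 4 * cbin n ^ 4 / sqrt (2 * real m + 1)"
proof -
  have "\<bar>legw n * legm (2 * n) (real m + 1 / 2)\<bar> \<le> 2 * sqrt (2 * (real m + 1 / 2)) / (real m + 1 / 2) * cbin n ^ 4"
    by (rule legw_legm_bound) simp
  also have "2 * sqrt (2 * (real m + 1 / 2)) / (real m + 1 / 2) = 4 / sqrt (2 * real m + 1)"
  proof -
    define s where "s = sqrt (2 * real m + 1)"
    have s: "s > 0" by (simp add: s_def)
    have m: "real m + 1 / 2 = s ^ 2 / 2" by (simp add: s_def)
    show ?thesis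
      unfolding m s_def[symmetric] using s by (simp add: power2_eq_square)
  qed
  finally show ?thesis by simp
qed

lemma summable_three_halves: "summable (\<lambda>m. 1 / (sqrt (2 * real m + 1) * (2 * real m + 1)))"
proof (rule summable_comparison_test_ev[of _ "\<lambda>m. real m powr (- 3 / 2)"])
  show "summable (\<lambda>m. real m powr (- 3 / 2))"
    by (subst summable_real_powr_iff) simp
  have "\<forall>\<^sub>F m in sequentially. 1 / (sqrt (2 * real m + 1) * (2 * real m + 1)) \<le> real m powr (- 3 / 2)"
    using eventually_gt_at_top[of 0]
  proof eventually_elim
    case (elim m)
    have "real m powr (1 / 2 + 1) = sqrt (real m) * real m"
      using elim by (subst powr_add) (simp add: powr_half_sqrt)
    moreover have "- 3 / 2 = - (1 / 2 + 1 :: real)" by simp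
    ultimately have "real m powr (- 3 / 2) = 1 / (sqrt (real m) * real m)"
      by (simp only: powr_minus inverse_eq_divide)
    moreover have "1 / (sqrt (2 * real m + 1) * (2 * real m + 1)) \<le> 1 / (sqrt (real m) * real m)"
      using elim by (intro divide_left_mono mult_mono mult_pos_pos) auto
    ultimately show ?case by simp
  qed
  then show "\<forall>\<^sub>F m in sequentially. norm (1 / (sqrt (2 * real m + 1) * (2 * real m + 1))) \<le> real m powr (- 3 / 2)"
    by (rule eventually_mono) simp
qed

text \<open>Summing over \<open>n\<close> first gives the correlations by
  \<open>corr_eq_leg\<close>; summing over \<open>m\<close> first gives the odd tails. The common
  value is the \<open>X\<close> of the overview.\<close>

lemma corr_weighted_sums: 
  "\<exists>S. (\<lambda>n. legw n * odd_tail n) sums S \<and> (\<lambda>m. corr m / (2 * real m + 1)) sums S"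
proof (rule sums_swap_dominated[where u = "\<lambda>n m. legw n * legm (2 * n) (real m + 1 / 2) / (2 * (2 * real m + 1))"])
  show "summable (\<lambda>n. 4 * cbin n ^ 4)"
    by (intro summable_mult summable_cbin_pow4)
  show "summable (\<lambda>m. 1 / (sqrt (2 * real m + 1) * (2 * real m + 1)))"
    by (rule summable_three_halves)
  show "\<bar>legw n * legm (2 * n) (real m + 1 / 2) / (2 * (2 * real m + 1))\<bar> \<le> 4 * cbin n ^ 4 * (1 / (sqrt (2 * real m + 1) * (2 * real m + 1)))" for n m
  proof -
    have "\<bar>legw n * legm (2 * n) (real m + 1 / 2) / (2 * (2 * real m + 1))\<bar> \<le>
        4 * cbin n ^ 4 / sqrt (2 * real m + 1) / (1 * (2 * real m + 1))"
      unfolding abs_divide by (rule frac_le[OF _ legw_legm_bound_half]) auto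
    then show ?thesis by simp
  qed
  show "(\<lambda>m. legw n * legm (2 * n) (real m + 1 / 2) / (2 * (2 * real m + 1))) sums (legw n * odd_tail n)" for n
    using sums_mult[OF legm_weighted_sums[of n], of "legw n / 2"] by simp
  show "(\<lambda>n. legw n * legm (2 * n) (real m + 1 / 2) / (2 * (2 * real m + 1))) sums (corr m / (2 * real m + 1))" for m
  proof -
    have "(\<lambda>n. legw n * legm (2 * n) (real m + 1 / 2) / (2 * (2 * real m + 1))) sums (2 * corr m / (2 * (2 * real m + 1)))"
      unfolding corr_eq_leg[symmetric] by (intro sums_divide leg_sums) simp
    moreover have "2 * c / (2 * d) = c / d" for c d :: real by simp
    ultimately show ?thesis by (simp only:)
  qed
qed simp

lemma corr_shifted_weighted_sums: 
  "\<exists>S. (\<lambda>n. cbin n ^ 4 / (2 * (2 * real n + 1))) sums S \<and> (\<lambda>m. corr (m + 1) / (2 * real m + 1)) sums S"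
proof (rule sums_swap_dominated[where u = "\<lambda>n m. legw n * legm (2 * n) (real (m + 1) + 1 / 2) / (2 * (2 * real m + 1))"])
  show "summable (\<lambda>n. 4 * cbin n ^ 4)"
    by (intro summable_mult summable_cbin_pow4)
  show "summable (\<lambda>m. 1 / (sqrt (2 * real m + 1) * (2 * real m + 1)))"
    by (rule summable_three_halves)
  show "\<bar>legw n * legm (2 * n) (real (m + 1) + 1 / 2) / (2 * (2 * real m + 1))\<bar> \<le> 4 * cbin n ^ 4 * (1 / (sqrt (2 * real m + 1) * (2 * real m + 1)))" for n m
  proof -
    have "\<bar>legw n * legm (2 * n) (real (m + 1) + 1 / 2) / (2 * (2 * real m + 1))\<bar> \<le>
        4 * cbin n ^ 4 / sqrt (2 * real (m + 1) + 1) / (1 * (2 * real m + 1))"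
      unfolding abs_divide by (rule frac_le[OF _ legw_legm_bound_half]) auto
    also have "\<dots> \<le> 4 * cbin n ^ 4 / sqrt (2 * real m + 1) / (1 * (2 * real m + 1))"
      by (intro divide_right_mono divide_left_mono) auto
    finally show ?thesis by simp
  qed
  show "(\<lambda>m. legw n * legm (2 * n) (real (m + 1) + 1 / 2) / (2 * (2 * real m + 1))) sums (cbin n ^ 4 / (2 * (2 * real n + 1)))" for n
    using sums_mult[OF legm_shifted_weighted_sums[of n], of "legw n / 2"] by (simp add: legw_def add_nonneg_eq_0_iff)
  show "(\<lambda>n. legw n * legm (2 * n) (real (m + 1) + 1 / 2) / (2 * (2 * real m + 1))) sums (corr (m + 1) / (2 * real m + 1))" for m
  proof -
    have "(\<lambda>n. legw n * legm (2 * n) (real (m + 1) + 1 / 2) / (2 * (2 * real m + 1))) sums (2 * corr (m + 1) / (2 * (2 * real m + 1)))"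
      unfolding corr_eq_leg[symmetric] by (intro sums_divide leg_sums) simp
    moreover have "2 * c / (2 * d) = c / d" for c d :: real by simp
    ultimately show ?thesis by (simp only:)
  qed
qed simp

lemma legw_partial_sums:
  assumes "(\<lambda>n. legw n * odd_tail n) sums S"
  shows "(\<lambda>n. 1 / (2 * real n + 1) ^ 2 * (\<Sum>k=0..n. legw k)) sums S"
proof (rule sums_swap_nonneg[where u = "\<lambda>k n. if k \<le> n then legw k * (1 / (2 * real n + 1) ^ 2) else 0"])
  show "(\<lambda>n. if k \<le> n then legw k * (1 / (2 * real n + 1) ^ 2) else 0) sums (legw k * odd_tail k)" for k
  proof -
    have "(\<lambda>j. legw k * (1 / (2 * real (j + k) + 1) ^ 2)) sums (legw k * odd_tail k)"
      by (intro sums_mult odd_tail_sums)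
    then have "(\<lambda>j. if k \<le> j + k then legw k * (1 / (2 * real (j + k) + 1) ^ 2) else 0) sums (legw k * odd_tail k)"
      by simp
    \<comment> \<open>Shifting by \<open>k\<close> adds no initial sum, because the terms below
      \<open>k\<close> are zero.\<close>
    then show ?thesis
      by (subst (asm) sums_iff_shift) simp
  qed
  show "(\<lambda>k. if k \<le> n then legw k * (1 / (2 * real n + 1) ^ 2) else 0) sums (1 / (2 * real n + 1) ^ 2 * (\<Sum>k=0..n. legw k))" for n
  proof -
    have "(\<lambda>k. if k \<in> {0..n} then legw k * (1 / (2 * real n + 1) ^ 2) else 0) sums (\<Sum>k\<in>{0..n}. legw k * (1 / (2 * real n + 1) ^ 2))"
      by (rule sums_If_finite_set) simp
    then show ?thesis by (simp add: sum_divide_distrib[symmetric])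
  qed
qed (use assms legw_nonneg in auto)

subsection \<open>The Hilbert form\<close>

text \<open>Orthogonality of the Legendre polynomial of degree \<open>n\<close> to
  \<open>u^i\<close>: the factor with \<open>j = i + 1\<close> vanishes.\<close>

lemma legm_eq_0_nat: "n > i \<Longrightarrow> legm n (real i + 1) = 0"
proof -
  assume "n > i"
  then have "(\<Prod>j=1..n. (real i + 1 - real j) / (real i + 1 + real j)) = 0"
    by (intro prod_zero bexI[of _ "i + 1"]) auto
  then show ?thesis by (simp add: legm_def)
qed

lemma legm_nonneg_nat: "legm n (real i + 1) \<ge> 0"
proof (cases "n \<le> i")
  case True
  then show ?thesis unfolding legm_def by (intro divide_nonneg_nonneg prod_nonneg) auto
qed (simp add: legm_eq_0_nat)

text \<open>The identity behind the telescoping is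
  \<open>(2n + 1)(x + y - 1) = (x + n)(y + n) - (x - n - 1)(y - n - 1)\<close>.\<close>

lemma legm_kernel:
  assumes "x > 0" "y > 0"
  shows "(x + y - 1) * (\<Sum>n<N. (2 * real n + 1) * (legm n x * legm n y)) =
    1 - legm N x * legm N y * ((x + real N) * (y + real N))"
proof (induction N)
  case (Suc N)
  have "legm (Suc N) x * legm (Suc N) y * ((x + real (Suc N)) * (y + real (Suc N))) =
    legm N x * legm N y * ((x - real N - 1) * (y - real N - 1))"
  proof -
    have "x + real N + 1 \<noteq> 0" "y + real N + 1 \<noteq> 0" using assms by auto
    then have "a * (u / (x + real N + 1)) * (b * (v / (y + real N + 1))) * ((x + real N + 1) * (y + real N + 1)) = a * b * (u * v)"
      for a b u v by simp
    then show ?thesis unfolding legm_Suc of_nat_Suc by (simp add: add_ac)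
  qed
  then show ?case
    unfolding sum.lessThan_Suc distrib_left Suc by (simp add: algebra_simps)
qed (use assms in simp)

text \<open>At \<open>N = l + 1\<close> the remainder in \<open>legm_kernel\<close> vanishes, so the
  Legendre expansion of the Hilbert kernel is a finite sum.\<close>

lemma legm_kernel_nat:
  "(\<Sum>n<Suc l. (2 * real n + 1) * (legm n (real i + 1) * legm n (real l + 1))) = 1 / (real i + real l + 1)"
proof -
  have "(real i + 1 + (real l + 1) - 1) * (\<Sum>n<Suc l. (2 * real n + 1) * (legm n (real i + 1) * legm n (real l + 1))) = 1"
    by (subst legm_kernel) (simp_all add: legm_eq_0_nat)
  then show ?thesis by (simp add: field_simps add_nonneg_eq_0_iff del: sum.lessThan_Suc)
qed

lemma legm_Suc_arg_nat: "legm n (real i + 2) * ((real i + 1 - real n) * (real i + real n + 2)) = legm n (real i + 1) * (real i + 1) ^ 2"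
  using legm_shift[of "real i + 1" n] by (simp add: add_ac)

lemma cbin_legm_0_sums: "(\<lambda>i. cbin i ^ 2 * legm 0 (real i + 1)) sums (4 / pi)"
proof -
  have "(\<lambda>i. 4 * (real i * cbin i ^ 2)) \<longlonglongrightarrow> 4 * (1 / pi)"
    by (intro tendsto_intros cbin_sq_asymp)
  from telescope_sums[OF this] have "(\<lambda>i. 4 * (real (Suc i) * cbin (Suc i) ^ 2) - 4 * (real i * cbin i ^ 2)) sums (4 / pi)"
    by simp
  moreover have "4 * (real (Suc i) * cbin (Suc i) ^ 2) - 4 * (real i * cbin i ^ 2) = cbin i ^ 2 * legm 0 (real i + 1)" for i
  proof -
    define t where "t = real i + 1"
    have t: "t > 0" by (simp add: t_def)
    have e: "real (Suc i) = t" "2 * real i + 1 = 2 * t - 1" "2 * real i + 2 = 2 * t" "real i = t - 1" by (simp_all add: t_def)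
    show ?thesis
      unfolding cbin_Suc legm_0 e using t by (simp add: field_simps power2_eq_square)
  qed
  ultimately show ?thesis by (simp only:)
qed

text \<open>The sums over \<open>i\<close> are, up to sign and a constant, Legendre coefficients of
  \<open>K\<close> in the variable \<open>k^2\<close>. Two consecutive orders are linked by
  telescoping in \<open>i\<close>.\<close>

lemma cbin_legm_step:
  assumes "(\<lambda>i. cbin i ^ 2 * legm n (real i + 1)) sums s"
  shows "(\<lambda>i. cbin i ^ 2 * legm (Suc n) (real i + 1)) sums ((2 * real n + 1) ^ 2 * s / (2 * real n + 3) ^ 2)"
proof -
  define Y where "Y i = - 8 * (real n + 1) * ((real i - real n) * (cbin i ^ 2 * legm n (real i + 1)))" for i
  have step: "(2 * real n + 3) ^ 2 * (cbin i ^ 2 * legm (Suc n) (real i + 1)) - (2 * real n + 1) ^ 2 * (cbin i ^ 2 * legm n (real i + 1))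
      = Y (Suc i) - Y i" for i
  proof -
    define t r N L c where "t = real i + 1" and "r = real i" and "N = real n" and "L = legm n (real i + 1)" and "c = cbin i ^ 2"
    define p where "p = r + N + 2"
    have t: "t > 0" "p > 0" by (auto simp: t_def p_def r_def N_def)
    have L1: "legm (Suc n) (real i + 1) = L * ((r - N) / p)"
      by (simp add: legm_Suc L_def r_def N_def p_def add_ac)
    have sh: "legm n (real i + 2) * ((r + 1 - N) * p) = L * t ^ 2"
      using legm_Suc_arg_nat[of n i] by (simp add: L_def r_def N_def p_def t_def)
    have cs: "cbin (Suc i) ^ 2 = c * ((2 * r + 1) ^ 2 / (4 * t ^ 2))"
    proof -
      have two: "2 * real i + 2 = 2 * t" by (simp add: t_def)
      show ?thesis unfolding cbin_Suc two by (simp add: c_def r_def power_mult_distrib power_divide)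
    qed
    have "l * (k * p) = L * t ^ 2 \<Longrightarrow> k * (c * (m / (4 * t ^ 2)) * l) = c * L * m / (4 * p)" for k l m
      using t by (simp add: field_simps)
    from this[OF sh] have YS: "Y (Suc i) = - 8 * (N + 1) * (c * L * (2 * r + 1) ^ 2 / (4 * p))"
      unfolding Y_def cs by (simp add: N_def r_def add_ac)
    have Y0: "Y i = - 8 * (N + 1) * ((r - N) * (c * L))"
      by (simp add: Y_def N_def r_def c_def L_def)
    have "4 * p * (k * (c * (L * (m / p))) - l * (c * L)) = 4 * c * L * (k * m - l * p)" for k l m
      using t by (simp add: field_simps)
    moreover have "4 * p * (k * (c * L * m / (4 * p)) - k * (l * (c * L))) = c * L * (k * (m - 4 * l * p))" for k l m
      using t by (simp add: field_simps)
    moreover have "4 * c * L * ((2 * N + 3) ^ 2 * (r - N) - (2 * N + 1) ^ 2 * p) =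
        c * L * (- 8 * (N + 1) * ((2 * r + 1) ^ 2 - 4 * (r - N) * p))"
      unfolding p_def by algebra
    ultimately have "4 * p * ((2 * N + 3) ^ 2 * (c * (L * ((r - N) / p))) - (2 * N + 1) ^ 2 * (c * L)) =
        4 * p * (Y (Suc i) - Y i)"
      unfolding YS Y0 by (simp only:)
    moreover have "4 * p \<noteq> 0" using t by simp
    ultimately show ?thesis
      unfolding L1 N_def[symmetric] c_def[symmetric] L_def[symmetric] using mult_left_cancel by blast
  qed
  have "Y \<longlonglongrightarrow> 0"
  proof -
    have lim: "(\<lambda>i. - 8 * (real n + 1) * ((real i * cbin i ^ 2) * legm n (real i + 1) - real n * (cbin i ^ 2 * legm n (real i + 1))))
        \<longlonglongrightarrow> - 8 * (real n + 1) * ((1 / pi) * 0 - real n * 0)"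
    proof (intro tendsto_mult tendsto_diff tendsto_const cbin_sq_asymp)
      show "(\<lambda>i. cbin i ^ 2 * legm n (real i + 1)) \<longlonglongrightarrow> 0"
        using assms by (intro summable_LIMSEQ_zero) (rule sums_summable)
      show "(\<lambda>i. legm n (real i + 1)) \<longlonglongrightarrow> 0"
      proof (induction n)
        case 0
        show ?case unfolding legm_0 by real_asymp
      next
        case (Suc n)
        have "(\<lambda>i. (real i + 1 - real n - 1) / (real i + 1 + real n + 1)) \<longlonglongrightarrow> 1" by real_asymp
        from tendsto_mult[OF Suc this] show ?case by (simp add: legm_Suc)
      qed
    qed
    have "(\<lambda>i. - 8 * (real n + 1) * ((real i * cbin i ^ 2) * legm n (real i + 1) - real n * (cbin i ^ 2 * legm n (real i + 1)))) = Y"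
      by (rule ext) (simp add: Y_def algebra_simps)
    with lim have "Y \<longlonglongrightarrow> - 8 * (real n + 1) * ((1 / pi) * 0 - real n * 0)"
      by (simp only:)
    then show ?thesis by simp
  qed
  from telescope_sums[OF this] have "(\<lambda>i. Y (Suc i) - Y i) sums (- Y 0)" by simp
  \<comment> \<open>For \<open>n = 0\<close> the factor \<open>i - n\<close> vanishes at
    \<open>i = 0\<close>; for \<open>n > 0\<close> the moment does.\<close>
  moreover have "Y 0 = 0"
    using legm_eq_0_nat[of 0 n] by (cases "n = 0") (simp_all add: Y_def)
  ultimately have "(\<lambda>i. (2 * real n + 3) ^ 2 * (cbin i ^ 2 * legm (Suc n) (real i + 1)) - (2 * real n + 1) ^ 2 * (cbin i ^ 2 * legm n (real i + 1))) sums 0"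
    unfolding step by simp
  from sums_add[OF this sums_mult[OF assms, of "(2 * real n + 1) ^ 2"]]
  have "(\<lambda>i. (2 * real n + 3) ^ 2 * (cbin i ^ 2 * legm (Suc n) (real i + 1))) sums ((2 * real n + 1) ^ 2 * s)"
    by simp
  from sums_divide[OF this, of "(2 * real n + 3) ^ 2"] show ?thesis
    by (simp add: add_nonneg_eq_0_iff)
qed

lemma cbin_legm_sums: "(\<lambda>i. cbin i ^ 2 * legm n (real i + 1)) sums (4 / pi / (2 * real n + 1) ^ 2)"
proof (induction n)
  case 0
  then show ?case using cbin_legm_0_sums by simp
next
  case (Suc n)
  have "2 * real (Suc n) + 1 = 2 * real n + 3" by simp
  moreover have "a * (b / a) = b" if "a \<noteq> 0" for a b :: real using that by simp
  from this[of "(2 * real n + 1) ^ 2"] have "(2 * real n + 1) ^ 2 * (4 / pi / (2 * real n + 1) ^ 2) = 4 / pi"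
    by (simp add: add_nonneg_eq_0_iff)
  ultimately show ?case using cbin_legm_step[OF Suc] by (simp only:)
qed

section \<open>Row sums of the two bilinear forms\<close>

definition stieltjes :: "real \<Rightarrow> real" where
  "stieltjes t = (\<Sum>i. cbin i ^ 2 / (real i + t))"

text \<open>The argument \<open>l + 1\<close> belongs to the Hilbert form and
  \<open>- l - 1/2\<close> to the kernel \<open>1 / (2(l - i) + 1)\<close>. Convergence holds for
  every \<open>t\<close>: eventually \<open>|i + t| \<ge> i/2\<close>, and a vanishing denominator
  contributes 0.\<close>

lemma stieltjes_sums: "(\<lambda>i. cbin i ^ 2 / (real i + t)) sums stieltjes t"
  unfolding stieltjes_def
proof (rule summable_sums, rule summable_comparison_test_ev[of _ "\<lambda>i. 1 / real i ^ 2"])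
  show "summable (\<lambda>i. 1 / real i ^ 2)"
    using inverse_power_summable[of 2, where 'a = real] by (simp add: field_simps)
  show "\<forall>\<^sub>F i in sequentially. norm (cbin i ^ 2 / (real i + t)) \<le> 1 / real i ^ 2"
    using eventually_gt_at_top[of "nat \<lceil>2 * \<bar>t\<bar>\<rceil>"]
  proof eventually_elim
    case (elim i)
    then have i: "2 * \<bar>t\<bar> < real i" by linarith
    then have "real i / 2 \<le> \<bar>real i + t\<bar>" by linarith
    moreover have "cbin i ^ 2 \<le> 1 / (2 * real i)"
      using i by (intro order_trans[OF cbin_sq_le] divide_left_mono) auto
    ultimately have "cbin i ^ 2 / \<bar>real i + t\<bar> \<le> 1 / (2 * real i) / (real i / 2)"
      using i by (intro frac_le) auto
    then show ?case using i by (simp add: power2_eq_square)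
  qed
qed

lemma stieltjes_rec:
  assumes "\<And>i::nat. real i + t + 1 \<noteq> 0" and "t = 0 \<or> t \<noteq> 0 \<and> (\<forall>i::nat. real i + t \<noteq> 0)"
  shows "(2 * t + 1) ^ 2 * stieltjes (t + 1) - (2 * t) ^ 2 * stieltjes t = 4 / pi"
proof -
  define Y where "Y i = 4 * real i ^ 2 * cbin i ^ 2 / (real i + t)" for i
  have step: "(2 * t + 1) ^ 2 * (cbin i ^ 2 / (real i + (t + 1))) - (2 * t) ^ 2 * (cbin i ^ 2 / (real i + t)) = Y (Suc i) - Y i" for i
  proof -
    define r c where "r = real i" and "c = cbin i ^ 2"
    define p where "p = r + t + 1"
    have p: "p \<noteq> 0" using assms(1)[of i] by (simp add: p_def r_def)
    have YS: "Y (Suc i) = c * (2 * r + 1) ^ 2 / p"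
    proof -
      define s where "s = r + 1"
      have s: "s > 0" by (simp add: s_def r_def)
      have e: "2 * real i + 1 = 2 * r + 1" "2 * real i + 2 = 2 * s" "real (Suc i) = s" "real (Suc i) + t = p"
        by (simp_all add: r_def s_def p_def)
      show ?thesis unfolding Y_def cbin_Suc e(1,2,4) unfolding e
        using s by (simp add: power_mult_distrib power_divide c_def)
    qed
    have Y0: "Y i = c * (4 * r ^ 2) / (r + t)"
      by (simp add: Y_def r_def c_def)
    have p': "real i + (t + 1) = p" by (simp add: p_def r_def)
    have "c * ((2 * t + 1) ^ 2 - (2 * r + 1) ^ 2) / p = c * (4 * t ^ 2 - 4 * r ^ 2) / (r + t)"
    proof -
      have "(2 * t + 1) ^ 2 - (2 * r + 1) ^ 2 = 4 * (t - r) * p"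
        unfolding p_def by (simp add: power2_eq_square algebra_simps)
      then have "c * ((2 * t + 1) ^ 2 - (2 * r + 1) ^ 2) / p = c * (4 * (t - r))"
        using p by simp
      also have "\<dots> = c * (4 * t ^ 2 - 4 * r ^ 2) / (r + t)"
      proof (cases "r + t = 0")
        case True
        then have "t = 0" "r = 0" using assms(2) by (auto simp: r_def)
        then show ?thesis by simp
      next
        case False
        have "4 * t ^ 2 - 4 * r ^ 2 = 4 * (t - r) * (r + t)"
          by (simp add: power2_eq_square algebra_simps)
        then show ?thesis using False by simp
      qed
      finally show ?thesis .
    qed
    then show ?thesis
      unfolding YS Y0 p' by (simp add: r_def[symmetric] c_def[symmetric] power_mult_distrib right_diff_distrib diff_divide_distrib mult.commute)
  qed
  have "Y \<longlonglongrightarrow> 4 / pi"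
  proof -
    have "(\<lambda>i. 4 * (real i * cbin i ^ 2) * (real i / (real i + t))) \<longlonglongrightarrow> 4 * (1 / pi) * 1"
      by (intro tendsto_mult tendsto_const cbin_sq_asymp) real_asymp
    moreover have "4 * (real i * cbin i ^ 2) * (real i / (real i + t)) = Y i" for i
      by (simp add: Y_def power2_eq_square)
    ultimately show ?thesis by simp
  qed
  from telescope_sums[OF this] have "(\<lambda>i. Y (Suc i) - Y i) sums (4 / pi)"
    by (simp add: Y_def)
  moreover have "(\<lambda>i. Y (Suc i) - Y i) sums ((2 * t + 1) ^ 2 * stieltjes (t + 1) - (2 * t) ^ 2 * stieltjes t)"
    unfolding step[symmetric] by (intro sums_diff sums_mult stieltjes_sums)
  ultimately show ?thesis
    by (rule sums_unique2[symmetric])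
qed

text \<open>Both sides satisfy the recurrence \<open>stieltjes_rec\<close>, at \<open>t = l\<close> and at \<open>t = - l - 1/2\<close>.\<close>

lemma stieltjes_reflect: "stieltjes (- real l - 1 / 2) = - stieltjes (real l + 1)"
proof (induction l)
  case 0
  \<comment> \<open>At \<open>t = 0\<close> and at \<open>t = - 1/2\<close> one of the two
    coefficients vanishes, so the recurrence evaluates a single sum.\<close>
  have "stieltjes 1 = 4 / pi"
    using stieltjes_rec[of 0] by auto
  moreover have "- stieltjes (- 1 / 2) = 4 / pi"
  proof -
    have "real i + - 1 / 2 + 1 \<noteq> 0" for i by auto
    moreover have "real i + - 1 / 2 \<noteq> 0" for i
      using half_not_nat[of 0 i] by auto
    ultimately show ?thesis using stieltjes_rec[of "- 1 / 2"] by simp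
  qed
  ultimately show ?case by simp
next
  case (Suc l)
  define M where "M = real l + 1"
  have M: "M > 0" by (simp add: M_def)
  have "real i + M + 1 \<noteq> 0" "real i + M \<noteq> 0" for i by (auto simp: M_def add_nonneg_eq_0_iff)
  then have 1: "(2 * M + 1) ^ 2 * stieltjes (M + 1) - (2 * M) ^ 2 * stieltjes M = 4 / pi"
    using M by (intro stieltjes_rec) auto
  have "real i + (- M - 1 / 2) \<noteq> 0" "real i + (- M - 1 / 2) + 1 \<noteq> 0" for i
    using half_not_nat[of "l + 1" i] half_not_nat[of l i] by (auto simp: M_def)
  then have "(2 * (- M - 1 / 2) + 1) ^ 2 * stieltjes ((- M - 1 / 2) + 1) - (2 * (- M - 1 / 2)) ^ 2 * stieltjes (- M - 1 / 2) = 4 / pi"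
    by (intro stieltjes_rec) auto
  moreover have "stieltjes ((- M - 1 / 2) + 1) = - stieltjes M"
  proof -
    have "(- M - 1 / 2) + 1 = - real l - 1 / 2" by (simp add: M_def)
    then show ?thesis using Suc by (simp only: M_def)
  qed
  \<comment> \<open>Reflecting \<open>t\<close> to \<open>- t - 1/2\<close> exchanges the two
    coefficients of the recurrence.\<close>
  moreover have "(2 * (- M - 1 / 2) + 1) ^ 2 = (2 * M) ^ 2" "(2 * (- M - 1 / 2)) ^ 2 = (2 * M + 1) ^ 2"
    by (simp_all add: power2_eq_square algebra_simps)
  ultimately have "(2 * M + 1) ^ 2 * stieltjes (- M - 1 / 2) = (2 * M + 1) ^ 2 * - stieltjes (M + 1)"
    using 1 by simp
  moreover have "(2 * M + 1) ^ 2 \<noteq> 0" using M by simp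
  ultimately have "stieltjes (- M - 1 / 2) = - stieltjes (M + 1)"
    using mult_left_cancel by blast
  then show ?case by (simp add: M_def add_ac)
qed

text \<open>The Hilbert kernel is replaced by its Legendre expansion. Each order contributes the
  square of \<open>4 / pi / (2n + 1)^2\<close> times \<open>2n + 1\<close>, hence the cubes;
  nonnegative moments justify the exchange.\<close>

lemma hilbert_form_sums:
  "(\<lambda>l. cbin l ^ 2 * stieltjes (real l + 1)) sums (16 / pi ^ 2 * (\<Sum>n. 1 / (2 * real n + 1) ^ 3))"
proof (rule sums_swap_nonneg[where u = "\<lambda>n l. 4 / pi / (2 * real n + 1) * (cbin l ^ 2 * legm n (real l + 1))"])
  show "0 \<le> 4 / pi / (2 * real n + 1) * (cbin l ^ 2 * legm n (real l + 1))" for n l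
    by (intro mult_nonneg_nonneg legm_nonneg_nat) auto
  show "(\<lambda>l. 4 / pi / (2 * real n + 1) * (cbin l ^ 2 * legm n (real l + 1))) sums (16 / pi ^ 2 * (1 / (2 * real n + 1) ^ 3))" for n
  proof -
    have "4 / p / d * (4 / p / d ^ 2) = 16 / p ^ 2 * (1 / d ^ 3)" for p d :: real
      by (simp add: power2_eq_square power3_eq_cube mult_ac)
    with sums_mult[OF cbin_legm_sums[of n], of "4 / pi / (2 * real n + 1)"] show ?thesis
      by (simp only:)
  qed
  show "(\<lambda>n. 16 / pi ^ 2 * (1 / (2 * real n + 1) ^ 3)) sums (16 / pi ^ 2 * (\<Sum>n. 1 / (2 * real n + 1) ^ 3))"
    by (intro sums_mult summable_sums summable_inverse_odd_power) simp
  show "(\<lambda>n. 4 / pi / (2 * real n + 1) * (cbin l ^ 2 * legm n (real l + 1))) sums (cbin l ^ 2 * stieltjes (real l + 1))" for l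
  proof -
    \<comment> \<open>The number of orders depends only on \<open>l\<close>, so the sum over
      \<open>i\<close> may be taken inside the finite sum.\<close>
    have "(\<lambda>i. \<Sum>n<Suc l. (2 * real n + 1) * legm n (real l + 1) * (cbin i ^ 2 * legm n (real i + 1))) sums
        (\<Sum>n<Suc l. (2 * real n + 1) * legm n (real l + 1) * (4 / pi / (2 * real n + 1) ^ 2))"
      by (intro sums_sum sums_mult cbin_legm_sums)
    moreover have "(\<Sum>n<Suc l. (2 * real n + 1) * legm n (real l + 1) * (cbin i ^ 2 * legm n (real i + 1))) =
        cbin i ^ 2 / (real i + (real l + 1))" for i
    proof -
      have "(\<Sum>n<Suc l. (2 * real n + 1) * legm n (real l + 1) * (cbin i ^ 2 * legm n (real i + 1))) =
        cbin i ^ 2 * (\<Sum>n<Suc l. (2 * real n + 1) * (legm n (real i + 1) * legm n (real l + 1)))"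
        unfolding sum_distrib_left by (intro sum.cong) (simp_all add: mult_ac)
      then show ?thesis unfolding legm_kernel_nat by (simp add: add_ac)
    qed
    ultimately have "(\<lambda>i. cbin i ^ 2 / (real i + (real l + 1))) sums
        (\<Sum>n<Suc l. (2 * real n + 1) * legm n (real l + 1) * (4 / pi / (2 * real n + 1) ^ 2))"
      by (simp only:)
    from sums_unique2[OF stieltjes_sums this]
    have st: "stieltjes (real l + 1) = (\<Sum>n<Suc l. (2 * real n + 1) * legm n (real l + 1) * (4 / pi / (2 * real n + 1) ^ 2))" .
    have "(\<lambda>n. 4 / pi / (2 * real n + 1) * (cbin l ^ 2 * legm n (real l + 1))) sums
       (\<Sum>n<Suc l. 4 / pi / (2 * real n + 1) * (cbin l ^ 2 * legm n (real l + 1)))"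
      by (rule sums_finite) (simp_all add: legm_eq_0_nat)
    also have "(\<Sum>n<Suc l. 4 / pi / (2 * real n + 1) * (cbin l ^ 2 * legm n (real l + 1))) = cbin l ^ 2 * stieltjes (real l + 1)"
      unfolding st sum_distrib_left
      by (intro sum.cong) (simp_all add: power2_eq_square add_nonneg_eq_0_iff)
    finally show ?thesis .
  qed
qed

lemma corr_weighted_diff:
  assumes "(\<lambda>m. corr m / (2 * real m + 1)) sums S" and "(\<lambda>m. corr (m + 1) / (2 * real m + 1)) sums S'"
  shows "2 * (S - S') = 16 / pi ^ 2 * (\<Sum>n. 1 / (2 * real n + 1) ^ 3)"
proof -
  \<comment> \<open>The form over all pairs: the part \<open>i \<le> l\<close> is \<open>S\<close>
    through \<open>l = i + m\<close>, and the part \<open>i > l\<close> is \<open>- S'\<close>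
    through \<open>i = l + m + 1\<close>.\<close>
  define E where "E = (\<lambda>(l, i). cbin i ^ 2 * cbin l ^ 2 / (2 * (real l - real i) + 1))"
  have "((\<lambda>(m, i). cbin i ^ 2 * cbin (i + m) ^ 2 / (2 * real m + 1)) has_sum S) UNIV"
    by (rule has_sum_nonneg_rows[OF _ sums_divide[OF corr_sums] assms(1)]) simp
  then have 1: "(E has_sum S) {(l, i). i \<le> l}"
    by (rule has_sum_reindex_bij_witness[where i = "\<lambda>(l, i). (l - i, i)" and j = "\<lambda>(m, i). (i + m, i)", THEN iffD1, rotated -1])
       (auto simp: E_def)
  have "((\<lambda>(m, l). cbin l ^ 2 * cbin (l + (m + 1)) ^ 2 / (2 * real m + 1)) has_sum S') UNIV"
    by (rule has_sum_nonneg_rows[OF _ sums_divide[OF corr_sums] assms(2)]) simp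
  then have "((\<lambda>x. - (case x of (m, l) \<Rightarrow> cbin l ^ 2 * cbin (l + (m + 1)) ^ 2 / (2 * real m + 1))) has_sum - S') UNIV"
    by (subst has_sum_uminus) simp
  then have 2: "(E has_sum - S') {(l, i). i > l}"
  proof (rule has_sum_reindex_bij_witness[where i = "\<lambda>(l, i). (i - l - 1, l)" and j = "\<lambda>(m, l). (l, l + m + 1)", THEN iffD1, rotated -1])
    fix x :: "nat \<times> nat"
    obtain m l where x: "x = (m, l)" by force
    have "2 * (real l - real (l + m + 1)) + 1 = - (2 * real m + 1)" by simp
    then have "cbin (l + m + 1) ^ 2 * cbin l ^ 2 / (2 * (real l - real (l + m + 1)) + 1) = - (cbin l ^ 2 * cbin (l + (m + 1)) ^ 2 / (2 * real m + 1))"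
      by (simp only: divide_minus_right) (simp add: mult_ac)
    then show "E (case x of (m, l) \<Rightarrow> (l, l + m + 1)) = - (case x of (m, l) \<Rightarrow> cbin l ^ 2 * cbin (l + (m + 1)) ^ 2 / (2 * real m + 1))"
      by (simp add: x E_def)
  qed auto
  have "(E has_sum (S + - S')) ({(l, i). i \<le> l} \<union> {(l, i). i > l})"
    by (rule has_sum_Un_disjoint[OF 1 2]) auto
  also have "{(l, i). i \<le> l} \<union> {(l, i). i > l} = (UNIV :: (nat \<times> nat) set)" by auto
  \<comment> \<open>Unconditional summability on both triangles permits summation by full rows,
    where \<open>stieltjes_reflect\<close> turns each row into half a row of the Hilbert
    form.\<close>
  finally have "(\<lambda>l. cbin l ^ 2 * (stieltjes (real l + 1) / 2)) sums (S + - S')"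
    unfolding E_def
  proof (rule has_sum_rows_sums)
    fix l
    have "(\<lambda>i. - (cbin l ^ 2 / 2) * (cbin i ^ 2 / (real i + (- real l - 1 / 2)))) sums (- (cbin l ^ 2 / 2) * stieltjes (- real l - 1 / 2))"
      by (intro sums_mult stieltjes_sums)
    moreover have "- (cbin l ^ 2 / 2) * (cbin i ^ 2 / (real i + (- real l - 1 / 2))) = cbin i ^ 2 * cbin l ^ 2 / (2 * (real l - real i) + 1)" for i
    proof -
      have "2 * (real l - real i) + 1 = - 2 * (real i + (- real l - 1 / 2))" by simp
      moreover have "- (c / 2) * (b / d) = b * c / (- 2 * d)" for b c d :: real by simp
      ultimately show ?thesis by (simp only:)
    qed
    ultimately show "(\<lambda>i. cbin i ^ 2 * cbin l ^ 2 / (2 * (real l - real i) + 1)) sums (cbin l ^ 2 * (stieltjes (real l + 1) / 2))"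
      by (simp add: stieltjes_reflect)
  qed
  from sums_mult[OF this, of 2] have "(\<lambda>l. cbin l ^ 2 * stieltjes (real l + 1)) sums (2 * (S - S'))"
    by simp
  from sums_unique2[OF this hilbert_form_sums] show ?thesis .
qed

text \<open>Pairing consecutive terms separates odd from even denominators; the even ones give one
  eighth of the whole series.\<close>

lemma odd_zeta_3: "(\<Sum>n. 1 / (2 * real n + 1) ^ 3) = 7 / 8 * real_zeta 3"
proof -
  define f where "f n = 1 / real (Suc n) ^ 3" for n
  have "summable f"
    unfolding f_def using summable_Suc_iff[of "\<lambda>n. 1 / real n ^ 3"] inverse_power_summable[of 3, where 'a = real] by (simp add: field_simps)
  moreover have "(\<lambda>n. 1 / real (Suc n) powr 3) = f"
    by (rule ext) (simp add: f_def powr_numeral)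
  ultimately have f: "f sums real_zeta 3"
    unfolding real_zeta_def by (simp only: summable_sums)
  then have "(\<lambda>n. sum f {n * 2..<n * 2 + 2}) sums real_zeta 3"
    by (rule sums_group) simp
  moreover have "sum f {n * 2..<n * 2 + 2} = 1 / (2 * real n + 1) ^ 3 + f n / 8" for n
  proof -
    have "{n * 2..<n * 2 + 2} = {2 * n, 2 * n + 1}" by auto
    then have "sum f {n * 2..<n * 2 + 2} = f (2 * n) + f (2 * n + 1)" by simp
    moreover have "f (2 * n) = 1 / (2 * real n + 1) ^ 3" by (simp add: f_def add.commute)
    moreover have "f (2 * n + 1) = f n / 8"
    proof -
      have "real (Suc (2 * n + 1)) = 2 * real (Suc n)" by simp
      then show ?thesis unfolding f_def by (simp only: power_mult_distrib) simp
    qed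
    ultimately show ?thesis by simp
  qed
  ultimately have "(\<lambda>n. 1 / (2 * real n + 1) ^ 3 + f n / 8) sums real_zeta 3" by simp
  from sums_diff[OF this sums_divide[OF f, of 8]]
  have "(\<lambda>n. 1 / (2 * real n + 1) ^ 3) sums (real_zeta 3 - real_zeta 3 / 8)" by simp
  then show ?thesis by (simp add: sums_iff)
qed

subsection \<open>The integral\<close>

text \<open>Half the Beta value \<open>B(j + 1/2, i + 1)\<close>.\<close>

definition beta_int :: "nat \<Rightarrow> nat \<Rightarrow> real" where
  "beta_int i j = (\<Prod>r=1..i. 2 * real r / (2 * real r + 2 * real j + 1)) / (2 * real j + 1)"

lemma beta_int_0: "beta_int 0 j = 1 / (2 * real j + 1)"
  by (simp add: beta_int_def)

lemma beta_int_Suc: "beta_int (Suc i) j = beta_int i j * ((2 * real i + 2) / (2 * real i + 2 * real j + 3))"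
  by (simp add: beta_int_def algebra_simps)

lemma beta_int_pos: "beta_int i j > 0"
  unfolding beta_int_def by (intro divide_pos_pos prod_pos) auto

lemma beta_int_Suc_right: "beta_int i (Suc j) = beta_int i j * ((2 * real j + 1) / (2 * real i + 2 * real j + 3))"
proof (induction i)
  case 0
  show ?case by (simp add: beta_int_0 add_nonneg_eq_0_iff add_ac)
next
  case (Suc i)
  define p q where "p = 2 * real i + 2 * real j + 3" and "q = 2 * real i + 2 * real j + 5"
  have e: "2 * real i + 2 * real (Suc j) + 3 = q" "2 * real (Suc i) + 2 * real j + 3 = q"
    by (simp_all add: q_def)
  show ?case
    unfolding beta_int_Suc Suc e p_def[symmetric] by (simp add: mult_ac)
qed

text \<open>Writing one factor \<open>1 - k^2\<close> as a difference lowers \<open>i\<close> and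
  needs the hypothesis at both \<open>j\<close> and \<open>j + 1\<close>, so \<open>j\<close> is
  left arbitrary.\<close>

lemma has_integral_beta_int: "((\<lambda>k::real. (1 - k\<^sup>2) ^ i * k ^ (2 * j)) has_integral beta_int i j) {0<..<1}"
proof (induction i arbitrary: j)
  case 0
  have "((\<lambda>k::real. k ^ (2 * j)) has_integral 1 ^ Suc (2 * j) / (2 * real j + 1) - 0 ^ Suc (2 * j) / (2 * real j + 1)) {0..1}"
  proof (rule fundamental_theorem_of_calculus)
    fix x :: real
    show "((\<lambda>k. k ^ Suc (2 * j) / (2 * real j + 1)) has_vector_derivative x ^ (2 * j)) (at x within {0..1})"
      unfolding has_real_derivative_iff_has_vector_derivative[symmetric]
      by (rule derivative_eq_intros refl | simp add: add_nonneg_eq_0_iff add.commute[of 1] del: power_Suc)+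
  qed simp
  then show ?case by (simp add: has_integral_Icc_iff_Ioo beta_int_0)
next
  case (Suc i)
  have "((\<lambda>k::real. (1 - k\<^sup>2) ^ i * k ^ (2 * j) - (1 - k\<^sup>2) ^ i * k ^ (2 * Suc j)) has_integral (beta_int i j - beta_int i (Suc j))) {0<..<1}"
    by (intro has_integral_diff Suc)
  moreover have "(1 - k\<^sup>2) ^ i * k ^ (2 * j) - (1 - k\<^sup>2) ^ i * k ^ (2 * Suc j) = (1 - k\<^sup>2) ^ Suc i * k ^ (2 * j)" for k :: real
    by (simp add: algebra_simps power2_eq_square)
  moreover have "beta_int i j - beta_int i (Suc j) = beta_int (Suc i) j"
  proof -
    define p where "p = 2 * real i + 2 * real j + 3"
    have p: "p > 0" by (simp add: p_def)
    have "b - b * (u / p) = b * ((p - u) / p)" for b u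
      using p by (simp add: field_simps)
    moreover have "p - (2 * real j + 1) = 2 * real i + 2" by (simp add: p_def)
    ultimately show ?thesis unfolding beta_int_Suc beta_int_Suc_right p_def[symmetric] by (simp only:)
  qed
  ultimately show ?case by (simp only:)
qed

lemma beta_int_0_right: "cbin i * beta_int i 0 = 1 / (2 * real i + 1)"
proof (induction i)
  case (Suc i)
  define p q where "p = 2 * real i + 1" and "q = 2 * real i + 2"
  have pq: "p > 0" "q > 0" by (auto simp: p_def q_def)
  have "cbin (Suc i) * beta_int (Suc i) 0 = (cbin i * beta_int i 0) * (p / q) * (q / (2 * real (Suc i) + 1))"
    by (simp add: cbin_Suc beta_int_Suc p_def q_def add_ac)
  also have "\<dots> = 1 / (2 * real (Suc i) + 1)"
    unfolding Suc p_def[symmetric] using pq by simp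
  finally show ?case .
qed (simp add: beta_int_0)

lemma beta_int_le: "beta_int i j \<le> beta_int i 0"
  unfolding beta_int_def
  by (intro frac_le prod_mono) (auto intro!: prod_nonneg divide_left_mono)

lemma cbin_beta_int_le: "cbin i ^ 2 * beta_int i j \<le> cbin i / (2 * real i + 1)"
proof -
  have "cbin i ^ 2 * beta_int i j \<le> cbin i ^ 2 * beta_int i 0"
    by (intro mult_left_mono beta_int_le) simp
  also have "\<dots> = cbin i * (cbin i * beta_int i 0)" by (simp add: power2_eq_square)
  finally show ?thesis by (simp add: beta_int_0_right)
qed

lemma cbin_le: "cbin i \<le> 1 / sqrt (2 * real i + 1)"
proof -
  have "cbin i \<le> sqrt (1 / (2 * real i + 1))"
    by (rule real_le_rsqrt[OF cbin_sq_le])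
  then show ?thesis by (simp add: real_sqrt_divide)
qed

text \<open>This is \<open>2 / pi\<close> times the integral of \<open>K'(k) k^(2j)\<close> over the
  unit interval.\<close>

definition beta_sum :: "nat \<Rightarrow> real" where
  "beta_sum j = (\<Sum>i. cbin i ^ 2 * beta_int i j)"

lemma beta_sum_sums: "(\<lambda>i. cbin i ^ 2 * beta_int i j) sums beta_sum j"
  unfolding beta_sum_def
proof (rule summable_sums, rule summable_comparison_test'[OF summable_three_halves])
  fix i
  have "cbin i ^ 2 * beta_int i j \<le> 1 / sqrt (2 * real i + 1) / (2 * real i + 1)"
    by (intro order_trans[OF cbin_beta_int_le] divide_right_mono cbin_le) auto
  then show "norm (cbin i ^ 2 * beta_int i j) \<le> 1 / (sqrt (2 * real i + 1) * (2 * real i + 1))"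
    using beta_int_pos[of i j] by (simp add: abs_mult)
qed

text \<open>The relation telescopes in \<open>i\<close> with \<open>Y\<close>, and it is the square
  of the recurrence of \<open>cbin\<close>; hence \<open>beta_sum j\<close> is proportional to
  \<open>cbin j ^ 2\<close>.\<close>

lemma beta_sum_rec: "(2 * real j + 2) ^ 2 * beta_sum (Suc j) = (2 * real j + 1) ^ 2 * beta_sum j"
proof -
  define u where "u = 2 * real j + 1"
  have u: "u > 0" by (simp add: u_def)
  define Y where "Y i = 2 * u * (real i * (cbin i ^ 2 * beta_int i j))" for i
  have step: "(u + 1) ^ 2 * (cbin i ^ 2 * beta_int i (Suc j)) - u ^ 2 * (cbin i ^ 2 * beta_int i j) = Y (Suc i) - Y i" for i
  proof -
    define r p c where "r = real i" and "p = 2 * real i + 2 * real j + 3" and "c = cbin i ^ 2 * beta_int i j"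
    define t where "t = r + 1"
    have t: "t > 0" "p > 0" by (auto simp: t_def r_def p_def)
    have A: "cbin i ^ 2 * beta_int i (Suc j) = c * (u / p)"
      unfolding beta_int_Suc_right by (simp add: c_def u_def p_def)
    have e: "real (Suc i) = t" "2 * real i + 2 = 2 * t" "2 * real i + 1 = 2 * r + 1" "real i = r"
      by (simp_all add: t_def r_def)
    have B: "Y (Suc i) = 2 * u * (t * (c * (((2 * r + 1) / (2 * t)) ^ 2 * (2 * t / p))))"
      unfolding Y_def cbin_Suc beta_int_Suc p_def[symmetric] e(1-3) power_mult_distrib[of "cbin i"] by (simp add: c_def)
    also have "2 * u * (t * (c * ((w / (2 * t)) ^ 2 * (2 * t / p)))) = u * (c * (w ^ 2 / p))" for w
      using t by (simp add: power_divide power2_eq_square)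
    finally have B: "Y (Suc i) = u * (c * ((2 * r + 1) ^ 2 / p))" .
    have C: "Y i = 2 * u * (r * c)" by (simp add: Y_def r_def c_def)
    have "p * (k * (c * (u / p)) - u ^ 2 * c) = u * c * (k - u * p)" for k
      using t by (simp add: field_simps power2_eq_square)
    moreover have "p * (u * (c * (k / p)) - 2 * u * (r * c)) = u * c * (k - 2 * r * p)" for k
      using t by (simp add: field_simps)
    moreover have "(u + 1) ^ 2 - u * p = (2 * r + 1) ^ 2 - 2 * r * p"
    proof -
      have "p = 2 * r + u + 2" by (simp add: p_def r_def u_def)
      then show ?thesis by (simp add: power2_eq_square algebra_simps)
    qed
    ultimately have "p * ((u + 1) ^ 2 * (c * (u / p)) - u ^ 2 * c) = p * (Y (Suc i) - Y i)"
      unfolding B C by (simp only:)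
    then show ?thesis
      unfolding A c_def[symmetric] using t by simp
  qed
  have "Y \<longlonglongrightarrow> 0"
  proof (rule tendsto_0_le)
    show "(\<lambda>i. 1 / sqrt (2 * real i + 1)) \<longlonglongrightarrow> 0" by real_asymp
    show "\<forall>\<^sub>F i in sequentially. norm (Y i) \<le> norm (1 / sqrt (2 * real i + 1)) * (2 * u)"
    proof (rule always_eventually, rule allI)
      fix i
      have "real i * (cbin i ^ 2 * beta_int i j) \<le> real i * (cbin i / (2 * real i + 1))"
        by (intro mult_left_mono cbin_beta_int_le) simp
      also have "\<dots> = cbin i * (real i / (2 * real i + 1))" by simp
      also have "\<dots> \<le> 1 / sqrt (2 * real i + 1) * 1"
        by (intro mult_mono cbin_le) auto
      finally have "2 * u * (real i * (cbin i ^ 2 * beta_int i j)) \<le> 2 * u * (1 / sqrt (2 * real i + 1))"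
        using u by (intro mult_left_mono) auto
      then show "norm (Y i) \<le> norm (1 / sqrt (2 * real i + 1)) * (2 * u)"
        using u beta_int_pos[of i j] by (simp add: Y_def abs_mult mult_ac)
    qed
  qed
  from telescope_sums[OF this] have "(\<lambda>i. Y (Suc i) - Y i) sums 0" by (simp add: Y_def)
  moreover have "(\<lambda>i. Y (Suc i) - Y i) sums ((u + 1) ^ 2 * beta_sum (Suc j) - u ^ 2 * beta_sum j)"
    unfolding step[symmetric] by (intro sums_diff sums_mult beta_sum_sums)
  ultimately have "(u + 1) ^ 2 * beta_sum (Suc j) - u ^ 2 * beta_sum j = 0"
    by (rule sums_unique2[symmetric])
  then show ?thesis by (simp add: u_def add_ac)
qed

lemma beta_sum_eq_0: "beta_sum j = cbin j ^ 2 * beta_sum 0"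
proof (induction j)
  case (Suc j)
  have "(2 * real j + 2) ^ 2 \<noteq> 0" by (simp add: add_nonneg_eq_0_iff)
  then have "beta_sum (Suc j) = (2 * real j + 1) ^ 2 * beta_sum j / (2 * real j + 2) ^ 2"
    using beta_sum_rec[of j] by (simp add: nonzero_eq_divide_eq mult.commute)
  then show ?case
    unfolding cbin_Suc Suc by (simp add: power_mult_distrib power_divide)
qed simp

text \<open>For positive first index the scaled terms are of order \<open>1/j\<close>, with a factor
  independent of the index. Equality holds at index 1, and every further factor is largest at
  \<open>j = 0\<close>.\<close>

lemma beta_int_Suc_le: "(2 * real j + 1) * beta_int (Suc i) j \<le> 3 / (2 * real j + 3) * beta_int (Suc i) 0"
proof (induction i)
  case 0
  have e: "beta_int (Suc 0) j = 1 / (2 * real j + 1) * (2 / (2 * real j + 3))"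
    unfolding beta_int_Suc beta_int_0 by simp
  have cancel: "u * (1 / u * v) = v" if "u > 0" for u v :: real using that by simp
  have "(2 * real j + 1) * beta_int (Suc 0) j = 2 / (2 * real j + 3)"
    unfolding e by (rule cancel) simp
  also have "\<dots> = 3 / (2 * real j + 3) * beta_int (Suc 0) 0"
  proof -
    have b: "beta_int (Suc 0) 0 = 2 / 3" unfolding beta_int_Suc beta_int_0 by simp
    have thirds: "2 / q = 3 / q * (2 / 3)" for q :: real by simp
    show ?thesis unfolding b by (rule thirds)
  qed
  finally show ?case by simp
next
  case (Suc i)
  define n where "n = Suc i"
  have "(2 * real j + 1) * beta_int (Suc n) j = (2 * real j + 1) * beta_int n j * ((2 * real n + 2) / (2 * real n + 2 * real j + 3))"
    by (simp add: beta_int_Suc)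
  also have "\<dots> \<le> 3 / (2 * real j + 3) * beta_int n 0 * ((2 * real n + 2) / (2 * real n + 2 * real 0 + 3))"
  proof (rule mult_mono)
    show "(2 * real j + 1) * beta_int n j \<le> 3 / (2 * real j + 3) * beta_int n 0"
      using Suc unfolding n_def .
    show "(2 * real n + 2) / (2 * real n + 2 * real j + 3) \<le> (2 * real n + 2) / (2 * real n + 2 * real 0 + 3)"
      by (intro divide_left_mono) auto
  qed (use beta_int_pos[of n 0] in auto)
  also have "\<dots> = 3 / (2 * real j + 3) * beta_int (Suc n) 0"
    by (simp add: beta_int_Suc)
  finally show ?case by (simp only: n_def)
qed

text \<open>Only the first term of \<open>(2j + 1) beta_sum j\<close> survives as \<open>j \<rightarrow> \<infinity>\<close>, so the limit is \<open>1\<close>; on the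
  other hand \<open>(2j + 1) c\<^sub>j\<^sup>2\<close> tends to \<open>2 / \<pi>\<close> by Wallis.\<close>

lemma beta_sum_0: "beta_sum 0 = pi / 2"
proof -
  define g where "g j = (2 * real j + 1) * beta_sum j" for j
  have bounds: "1 \<le> g j \<and> g j \<le> 1 + 3 / (2 * real j + 3) * beta_sum 0" for j
  proof -
    have s: "(\<lambda>i. (2 * real j + 1) * (cbin i ^ 2 * beta_int i j)) sums g j"
      unfolding g_def by (intro sums_mult beta_sum_sums)
    have "(2 * real j + 1) * (cbin 0 ^ 2 * beta_int 0 j) = 1"
      by (simp add: beta_int_0 add_nonneg_eq_0_iff)
    then have s1: "(\<lambda>i. (2 * real j + 1) * (cbin (Suc i) ^ 2 * beta_int (Suc i) j)) sums (g j - 1)"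
      using s by (subst sums_Suc_iff) simp
    have s2: "(\<lambda>i. 3 / (2 * real j + 3) * (cbin (Suc i) ^ 2 * beta_int (Suc i) 0)) sums (3 / (2 * real j + 3) * (beta_sum 0 - 1))"
      using beta_sum_sums[of 0] by (intro sums_mult, subst sums_Suc_iff) (simp add: beta_int_0)
    have "g j - 1 \<ge> 0"
      using beta_int_pos[of _ j] by (intro sums_le[OF _ sums_zero s1]) (auto intro!: mult_nonneg_nonneg less_imp_le)
    moreover have "g j - 1 \<le> 3 / (2 * real j + 3) * (beta_sum 0 - 1)"
    proof (rule sums_le[OF _ s1 s2])
      fix i
      show "(2 * real j + 1) * (cbin (Suc i) ^ 2 * beta_int (Suc i) j) \<le> 3 / (2 * real j + 3) * (cbin (Suc i) ^ 2 * beta_int (Suc i) 0)"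
        using mult_left_mono[OF beta_int_Suc_le[of j i], of "cbin (Suc i) ^ 2"] by (simp add: mult_ac)
    qed
    moreover have "3 / (2 * real j + 3) * (beta_sum 0 - 1) \<le> 3 / (2 * real j + 3) * beta_sum 0"
      by (intro mult_left_mono) auto
    ultimately show ?thesis by linarith
  qed
  have "(\<lambda>j. 1 + 3 / (2 * real j + 3) * beta_sum 0) \<longlonglongrightarrow> 1 + 0 * beta_sum 0"
    by (intro tendsto_add tendsto_mult tendsto_const) real_asymp
  then have "g \<longlonglongrightarrow> 1"
    by (intro tendsto_sandwich[OF _ _ tendsto_const, of 1 g sequentially "\<lambda>j. 1 + 3 / (2 * real j + 3) * beta_sum 0"])
       (use bounds in simp_all)
  moreover have "g \<longlonglongrightarrow> 2 / pi * beta_sum 0"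
  proof -
    have "(\<lambda>j. (2 * (real j * cbin j ^ 2) + cbin j ^ 2) * beta_sum 0) \<longlonglongrightarrow> (2 * (1 / pi) + 0) * beta_sum 0"
    proof (intro tendsto_intros cbin_sq_asymp)
      show "(\<lambda>j. cbin j ^ 2) \<longlonglongrightarrow> 0"
      proof (rule tendsto_0_le)
        show "(\<lambda>j. 1 / (2 * real j + 1)) \<longlonglongrightarrow> 0" by real_asymp
      qed (use cbin_sq_le in \<open>auto intro!: always_eventually\<close>)
    qed
    moreover have "(\<lambda>j. (2 * (real j * cbin j ^ 2) + cbin j ^ 2) * beta_sum 0) = g"
      unfolding g_def beta_sum_eq_0[symmetric] by (rule ext) (subst (2) beta_sum_eq_0, simp add: algebra_simps)
    ultimately show ?thesis by simp
  qed
  ultimately have "2 / pi * beta_sum 0 = 1"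
    by (rule LIMSEQ_unique[symmetric])
  then show ?thesis by (simp add: field_simps)
qed

section \<open>Series of the elliptic integrals and the logarithm, and termwise integration\<close>

lemma cbin_pochhammer: "pochhammer (1 / 2) n / fact n = cbin n"
proof (induction n)
  case (Suc n)
  have "pochhammer (1 / 2) (Suc n) / fact (Suc n) = (pochhammer (1 / 2) n / fact n) * ((1 / 2 + real n) / (real n + 1))"
    by (simp add: pochhammer_Suc add.commute)
  also have "(1 / 2 + real n) / (real n + 1) = (2 * real n + 1) / (2 * real n + 2)"
    by (simp add: divide_simps)
  finally show ?case by (simp add: Suc cbin_Suc)
qed simp

lemma hyp2F1_half: "hyp2F1 (1 / 2) (1 / 2) 1 z = (\<Sum>n. cbin n ^ 2 * z ^ n)"
  unfolding hyp2F1_series by (simp add: cbin_pochhammer[symmetric] pochhammer_fact[symmetric] power2_eq_square)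

lemma hyp2F1_half_sums:
  assumes "\<bar>z\<bar> < 1"
  shows "(\<lambda>n. cbin n ^ 2 * z ^ n) sums hyp2F1 (1 / 2) (1 / 2) 1 z"
  unfolding hyp2F1_half
proof (rule summable_sums, rule summable_comparison_test'[OF summable_geometric])
  show "norm \<bar>z\<bar> < 1" using assms by simp
  show "norm (cbin n ^ 2 * z ^ n) \<le> \<bar>z\<bar> ^ n" for n
    using mult_right_mono[OF cbin_sq_le_1[of n], of "\<bar>z\<bar> ^ n"] by (simp add: abs_mult power_abs)
qed

lemma ellK_sums: "0 < k \<Longrightarrow> k < 1 \<Longrightarrow> (\<lambda>n. pi / 2 * (cbin n ^ 2 * k ^ (2 * n))) sums ellK k"
  unfolding ellK_def power_mult by (intro sums_mult hyp2F1_half_sums) (simp add: power_less_one_iff abs_square_less_1)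

lemma ellK'_sums: "0 < k \<Longrightarrow> k < 1 \<Longrightarrow> (\<lambda>n. pi / 2 * (cbin n ^ 2 * (1 - k\<^sup>2) ^ n)) sums ellK' k"
  unfolding ellK'_def
  by (intro sums_mult hyp2F1_half_sums) (use abs_square_less_1[of k] in \<open>simp add: abs_if zero_less_power\<close>)

text \<open>The formula \<open>hyp2F1_half\<close> equates two values of \<open>suminf\<close> at
  every argument, convergent or not, so measurability follows globally.\<close>

lemma ellK_measurable [measurable]: "ellK \<in> borel_measurable borel" "ellK' \<in> borel_measurable borel"
  unfolding ellK_def[abs_def] ellK'_def[abs_def] hyp2F1_half by measurable

lemma ellK_nonneg:
  assumes "0 < k" "k < 1"
  shows "ellK k \<ge> 0" "ellK' k \<ge> 0"
proof -
  have "k\<^sup>2 \<le> 1" using assms by (simp add: power_le_one)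
  then show "ellK k \<ge> 0" "ellK' k \<ge> 0"
    using assms sums_le[OF _ sums_zero ellK_sums[OF assms]] sums_le[OF _ sums_zero ellK'_sums[OF assms]] by simp_all
qed

text \<open>All terms are nonnegative on the interval, so sum and integral are exchanged by monotone
  convergence.\<close>

lemma nn_integral_ellK'_power:
  "(\<integral>\<^sup>+k. ennreal (ellK' k * k ^ (2 * j)) * indicator {0<..<1} k \<partial>lborel) = ennreal (pi ^ 2 / 4 * cbin j ^ 2)"
proof -
  have "ennreal (ellK' k * k ^ (2 * j)) * indicator {0<..<1} k =
      (\<Sum>i. ennreal (pi / 2 * cbin i ^ 2) * (ennreal ((1 - k\<^sup>2) ^ i * k ^ (2 * j)) * indicator {0<..<1} k))" for k :: real
  proof (cases "k \<in> {0<..<1}")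
    case True
    then have k: "0 < k" "k < 1" by auto
    have k2: "k\<^sup>2 \<le> 1" using k by (simp add: power_le_one)
    have "(\<lambda>i. pi / 2 * (cbin i ^ 2 * (1 - k\<^sup>2) ^ i) * k ^ (2 * j)) sums (ellK' k * k ^ (2 * j))"
      by (intro sums_mult2 ellK'_sums k)
    then have "(\<Sum>i. ennreal (pi / 2 * (cbin i ^ 2 * (1 - k\<^sup>2) ^ i) * k ^ (2 * j))) = ennreal (ellK' k * k ^ (2 * j))"
      using k k2 by (intro suminf_ennreal_eq) auto
    moreover have "ennreal (pi / 2 * (cbin i ^ 2 * (1 - k\<^sup>2) ^ i) * k ^ (2 * j)) = ennreal (pi / 2 * cbin i ^ 2) * ennreal ((1 - k\<^sup>2) ^ i * k ^ (2 * j))" for i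
      using k k2 by (subst ennreal_mult'[symmetric]) (auto simp: mult_ac)
    ultimately show ?thesis using True by simp
  qed simp
  then have "(\<integral>\<^sup>+k. ennreal (ellK' k * k ^ (2 * j)) * indicator {0<..<1} k \<partial>lborel) =
      (\<Sum>i. \<integral>\<^sup>+k. ennreal (pi / 2 * cbin i ^ 2) * (ennreal ((1 - k\<^sup>2) ^ i * k ^ (2 * j)) * indicator {0<..<1} k) \<partial>lborel)"
    by (subst nn_integral_suminf[symmetric]) simp_all
  also have "\<dots> = (\<Sum>i. ennreal (pi / 2 * cbin i ^ 2) * ennreal (beta_int i j))"
  proof (rule suminf_cong)
    fix i
    have "(\<integral>\<^sup>+k. ennreal ((1 - k\<^sup>2) ^ i * k ^ (2 * j)) * indicator {0<..<1} k \<partial>lborel) = ennreal (beta_int i j)"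
    proof (rule nn_integral_has_integral_lebesgue'[OF _ has_integral_beta_int])
      fix k :: real assume "k \<in> {0<..<1}"
      then have "k\<^sup>2 \<le> 1" by (simp add: power_le_one)
      then show "0 \<le> (1 - k\<^sup>2) ^ i * k ^ (2 * j)" by simp
    qed
    then show "(\<integral>\<^sup>+k. ennreal (pi / 2 * cbin i ^ 2) * (ennreal ((1 - k\<^sup>2) ^ i * k ^ (2 * j)) * indicator {0<..<1} k) \<partial>lborel) =
        ennreal (pi / 2 * cbin i ^ 2) * ennreal (beta_int i j)"
      by (subst nn_integral_cmult) simp_all
  qed
  also have "\<dots> = (\<Sum>i. ennreal (pi / 2 * (cbin i ^ 2 * beta_int i j)))"
    using beta_int_pos[of _ j] by (subst ennreal_mult'[symmetric]) (auto simp: mult_ac less_imp_le)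
  also have "\<dots> = ennreal (pi / 2 * beta_sum j)"
    using beta_int_pos[of _ j] by (intro suminf_ennreal_eq sums_mult beta_sum_sums) (auto simp: less_imp_le)
  also have "pi / 2 * beta_sum j = pi ^ 2 / 4 * cbin j ^ 2"
    unfolding beta_sum_eq_0[of j] beta_sum_0 by (simp add: power2_eq_square)
  finally show ?thesis .
qed

lemma ln_quotient_sums:
  assumes "0 < k" "k < 1"
  shows "(\<lambda>m. 2 * k ^ (2 * m) / (2 * real m + 1)) sums (ln ((1 + k) / (1 - k)) / k)"
proof -
  \<comment> \<open>Even powers cancel, and the term at 0 is zero because its numerator is; pairing
    the terms keeps only the odd powers.\<close>
  define f where "f n = (k ^ n - (- k) ^ n) / real n" for n
  have "(\<lambda>n. - ((- k) ^ n) / real n - - ((- (- k)) ^ n) / real n) sums (ln (1 + k) - ln (1 + - k))"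
    using assms by (intro sums_diff ln_series') auto
  moreover have "- ((- k) ^ n) / real n - - ((- (- k)) ^ n) / real n = f n" for n
    by (simp add: f_def diff_divide_distrib)
  moreover have "ln (1 + k) - ln (1 + - k) = ln ((1 + k) / (1 - k))"
    using assms by (simp add: ln_div)
  ultimately have "f sums ln ((1 + k) / (1 - k))" by simp
  then have "(\<lambda>m. sum f {m * 2..<m * 2 + 2}) sums ln ((1 + k) / (1 - k))"
    by (rule sums_group) simp
  moreover have "sum f {m * 2..<m * 2 + 2} = 2 * k ^ (2 * m) / (2 * real m + 1) * k" for m
  proof -
    have "{m * 2..<m * 2 + 2} = {2 * m, 2 * m + 1}" by auto
    then show ?thesis by (simp add: f_def add.commute)
  qed
  ultimately have "(\<lambda>m. 2 * k ^ (2 * m) / (2 * real m + 1) * k) sums ln ((1 + k) / (1 - k))" by simp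
  from sums_divide[OF this, of k] show ?thesis using assms by simp
qed

text \<open>Only \<open>K\<close> and the logarithm are expanded; \<open>K'\<close> enters through
  its even moments. Summing over \<open>i\<close> for fixed \<open>m\<close> then produces
  \<open>corr m\<close>.\<close>

lemma nn_integral_ellK_ellK':
  assumes "(\<lambda>m. corr m / (2 * real m + 1)) sums S"
  shows "(\<integral>\<^sup>+k. ennreal (ellK k * ellK' k * ln ((1 + k) / (1 - k)) / k) * indicator {0<..<1} k \<partial>lborel) = ennreal (pi ^ 3 / 4 * S)"
proof -
  define c where "c m i = pi / (2 * real m + 1) * cbin i ^ 2" for m i
  have c0: "c m i \<ge> 0" for m i by (simp add: c_def)
  define h where "h j k = ennreal (ellK' k * k ^ (2 * j)) * indicator {0<..<1} k" for j and k :: real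
  have [measurable]: "h j \<in> borel_measurable borel" for j
    unfolding h_def[abs_def] by measurable
  have expand: "ennreal (ellK k * ellK' k * ln ((1 + k) / (1 - k)) / k) * indicator {0<..<1} k =
      (\<Sum>m. \<Sum>i. ennreal (c m i) * h (i + m) k)" for k :: real
  proof (cases "k \<in> {0<..<1}")
    case True
    then have k: "0 < k" "k < 1" by auto
    note nn = ellK_nonneg[OF k]
    have inner: "(\<Sum>i. ennreal (c m i) * h (i + m) k) = ennreal (2 * k ^ (2 * m) / (2 * real m + 1) * (ellK k * ellK' k))" for m
    proof -
      have "(\<lambda>i. 2 * k ^ (2 * m) / (2 * real m + 1) * (pi / 2 * (cbin i ^ 2 * k ^ (2 * i)) * ellK' k)) sums
          (2 * k ^ (2 * m) / (2 * real m + 1) * (ellK k * ellK' k))"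
        by (intro sums_mult sums_mult2 ellK_sums k)
      moreover have "2 * k ^ (2 * m) / (2 * real m + 1) * (pi / 2 * (cbin i ^ 2 * k ^ (2 * i)) * ellK' k) =
          c m i * (ellK' k * k ^ (2 * (i + m)))" for i
      proof -
        have "2 * u / d * (pi / 2 * (v * w) * z) = pi / d * v * (z * (w * u))" for u d v w z :: real by simp
        then show ?thesis unfolding c_def distrib_left power_add .
      qed
      ultimately have "(\<Sum>i. ennreal (c m i * (ellK' k * k ^ (2 * (i + m))))) = ennreal (2 * k ^ (2 * m) / (2 * real m + 1) * (ellK k * ellK' k))"
        using nn k c0 by (intro suminf_ennreal_eq) auto
      then show ?thesis
        using True by (simp add: h_def ennreal_mult' c0)
    qed
    have "(\<lambda>m. 2 * k ^ (2 * m) / (2 * real m + 1) * (ellK k * ellK' k)) sums (ln ((1 + k) / (1 - k)) / k * (ellK k * ellK' k))"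
      by (intro sums_mult2 ln_quotient_sums k)
    then have "(\<Sum>m. ennreal (2 * k ^ (2 * m) / (2 * real m + 1) * (ellK k * ellK' k))) = ennreal (ln ((1 + k) / (1 - k)) / k * (ellK k * ellK' k))"
      using nn k by (intro suminf_ennreal_eq) auto
    then show ?thesis
      unfolding inner using True by (simp add: mult_ac)
  qed (simp add: h_def)
  have "(\<integral>\<^sup>+k. ennreal (ellK k * ellK' k * ln ((1 + k) / (1 - k)) / k) * indicator {0<..<1} k \<partial>lborel) =
      (\<Sum>m. \<Sum>i. \<integral>\<^sup>+k. ennreal (c m i) * h (i + m) k \<partial>lborel)"
    unfolding expand by (subst nn_integral_suminf, simp, subst nn_integral_suminf, simp_all)
  also have "\<dots> = (\<Sum>m. \<Sum>i. ennreal (c m i) * ennreal (pi ^ 2 / 4 * cbin (i + m) ^ 2))"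
  proof -
    have "(\<integral>\<^sup>+k. h j k \<partial>lborel) = ennreal (pi ^ 2 / 4 * cbin j ^ 2)" for j
      unfolding h_def by (rule nn_integral_ellK'_power)
    then show ?thesis by (simp add: nn_integral_cmult)
  qed
  also have "\<dots> = (\<Sum>m. ennreal (pi ^ 3 / 4 / (2 * real m + 1) * corr m))"
  proof (rule suminf_cong)
    fix m
    have "ennreal (c m i) * ennreal (pi ^ 2 / 4 * cbin (i + m) ^ 2) = ennreal (pi ^ 3 / 4 / (2 * real m + 1) * (cbin i ^ 2 * cbin (i + m) ^ 2))" for i
      using c0[of m i] by (subst ennreal_mult'[symmetric]) (auto simp: c_def power2_eq_square power3_eq_cube mult_ac)
    then show "(\<Sum>i. ennreal (c m i) * ennreal (pi ^ 2 / 4 * cbin (i + m) ^ 2)) = ennreal (pi ^ 3 / 4 / (2 * real m + 1) * corr m)"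
      by (simp only:) (intro suminf_ennreal_eq sums_mult corr_sums, simp)
  qed
  also have "\<dots> = ennreal (pi ^ 3 / 4 * S)"
  proof (rule suminf_ennreal_eq)
    show "(\<lambda>m. pi ^ 3 / 4 / (2 * real m + 1) * corr m) sums (pi ^ 3 / 4 * S)"
      using sums_mult[OF assms, of "pi ^ 3 / 4"] by simp
  qed (simp add: corr_nonneg)
  finally show ?thesis .
qed

theorem theorem2p4:
  defines "f \<equiv> (\<lambda>k::real. ellK k * ellK' k * ln ((1 + k) / (1 - k)) / k)"
    and "a \<equiv> (\<lambda>n::nat. 1 / (2 * real n + 1)\<^sup>2 *
                (\<Sum>k=0..n. (4 * real k + 1) / 2 ^ (8 * k) * real ((2 * k) choose k) ^ 4))"
    and "b \<equiv> (\<lambda>n::nat. 1 / 2 ^ (8 * n) * real ((2 * n) choose n) ^ 4 * (1 / (2 * real n + 1)))"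
  shows "set_integrable lborel {0<..<1} f \<and> summable a \<and> summable b \<and>
    8 / pi ^ 3 * (LBINT k:{0<..<1}. f k) = 2 * (\<Sum>n. a n) \<and>
    14 * real_zeta 3 / pi\<^sup>2 + (\<Sum>n. b n) = 2 * (\<Sum>n. a n)"
proof -
  \<comment> \<open>\<open>S\<close> and \<open>S'\<close> are \<open>X\<close> and
    \<open>X'\<close> of the overview: \<open>a\<close> sums to \<open>S\<close> and
    \<open>b\<close> to \<open>2 * S'\<close>.\<close>
  obtain S where S: "(\<lambda>n. legw n * odd_tail n) sums S" "(\<lambda>m. corr m / (2 * real m + 1)) sums S"
    using corr_weighted_sums by blast
  obtain S' where S': "(\<lambda>n. cbin n ^ 4 / (2 * (2 * real n + 1))) sums S'" "(\<lambda>m. corr (m + 1) / (2 * real m + 1)) sums S'"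
    using corr_shifted_weighted_sums by blast
  have pow: "real ((2 * n) choose n) ^ 4 / 2 ^ (8 * n) = cbin n ^ 4" for n
  proof -
    have "(2::real) ^ (8 * n) = (4 ^ n) ^ 4"
      by (simp add: power_mult[symmetric] mult.commute[of n] flip: power_mult) (simp add: power_mult)
    then show ?thesis by (simp add: cbin_def power_divide)
  qed
  have "a = (\<lambda>n. 1 / (2 * real n + 1) ^ 2 * (\<Sum>k=0..n. legw k))"
    unfolding a_def legw_def pow[symmetric] by simp
  then have a: "a sums S"
    using legw_partial_sums[OF S(1)] by simp
  have "b = (\<lambda>n. 2 * (cbin n ^ 4 / (2 * (2 * real n + 1))))"
  proof
    fix n
    have "1 / e * x * (1 / d) = 2 * (x / e / (2 * d))" for e x d :: real by simp
    then show "b n = 2 * (cbin n ^ 4 / (2 * (2 * real n + 1)))" unfolding b_def pow[symmetric] .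
  qed
  then have b: "b sums (2 * S')"
    using sums_mult[OF S'(1), of 2] by simp
  have S0: "S \<ge> 0"
    by (rule sums_le[OF _ sums_zero S(2)]) (simp add: corr_nonneg)
  \<comment> \<open>The integrand is nonnegative, so its finite extended integral gives
    integrability and the value together.\<close>
  have "has_bochner_integral lborel (\<lambda>k. indicator {0<..<1} k *\<^sub>R f k) (pi ^ 3 / 4 * S)"
  proof (rule has_bochner_integral_nn_integral)
    show "(\<lambda>k. indicator {0<..<1} k *\<^sub>R f k) \<in> borel_measurable lborel"
      unfolding f_def by measurable
    show "AE k in lborel. 0 \<le> indicator {0<..<1} k *\<^sub>R f k"
      using ellK_nonneg by (auto simp: f_def indicator_def)
    have "(\<integral>\<^sup>+k. ennreal (indicator {0<..<1} k *\<^sub>R f k) \<partial>lborel) = (\<integral>\<^sup>+k. ennreal (f k) * indicator {0<..<1} k \<partial>lborel)"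
      by (intro nn_integral_cong) (simp add: indicator_def)
    then show "(\<integral>\<^sup>+k. ennreal (indicator {0<..<1} k *\<^sub>R f k) \<partial>lborel) = ennreal (pi ^ 3 / 4 * S)"
      unfolding f_def using nn_integral_ellK_ellK'[OF S(2)] by simp
  qed (use S0 in simp)
  then have f: "set_integrable lborel {0<..<1} f" "(LBINT k:{0<..<1}. f k) = pi ^ 3 / 4 * S"
    by (simp_all add: has_bochner_integral_iff set_integrable_def set_lebesgue_integral_def)
  \<comment> \<open>The constant is \<open>16 * 7/8 = 14\<close>, from the Hilbert form and the odd
    part of the zeta series.\<close>
  have "14 * real_zeta 3 / pi\<^sup>2 + 2 * S' = 2 * S"
    using corr_weighted_diff[OF S(2) S'(2)] unfolding odd_zeta_3 by (simp add: algebra_simps)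
  moreover have "8 / pi ^ 3 * (LBINT k:{0<..<1}. f k) = 2 * S"
    unfolding f(2) by simp
  ultimately show ?thesis
    using f(1) a b by (simp add: sums_iff)
qed

end
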